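(* Let $n=\prod_i p_i^{r_i}$ be a composite positive integer, with distinct primes $p_i$ and $r_i\ge1$. For each $i$ set $$C_i=\tfrac12\left(\gcd(n^2-1,p_i-1)-\gcd(n-1,p_i-1)\right),$$ $$D_i=\tfrac12\left(\gcd(p_i^2-1,n^2-1,n-p_i)-\gcd(n-1,p_i-1)\right).$$ Then $$L_2^-(n)=\frac12\prod_i (C_i+D_i)-\frac12\prod_{i:\,2\mid r_i}(C_i+D_i)\prod_{i:\,2\nmid r_i}(C_i-D_i).$$
   Context: For a positive integer $m$ and monic $g_1,g_2,h\in(\mathbb{Z}/m\mathbb{Z})[x]$, $\mathrm{gcmd}(g_1,g_2)=h$ means that the ideal generated by $g_1,g_2$ in $(\mathbb{Z}/m\mathbb{Z})[x]$ equals the ideal generated by $h$. A composite $n$ is a degree-2 Frobenius pseudoprime with respect to a monic quadratic $f$ with discriminant $\Delta$ (equivalently, $f$ is a liar for $n$) if all of the following hold: (1) $\gcd(n,f(0)\Delta)=1$; (2) modulo $n$, the polynomials $F_1=\mathrm{gcmd}(x^n-x,f)$, $f_1=f/F_1$, $F_2=\mathrm{gcmd}(x^{n^2}-x,f_1)$ and $f_2=f_1/F_2$ all exist, and $f_2=1$; (3) $F_2(x)\mid F_2(x^n)$; (4) $(-1)^{\deg(F_2)/2}=\left(\frac{\Delta}{n}\right)$ (Jacobi symbol). These conditions depend only on $f$ modulo $n$. $L_2^-(n)$ is the number of monic quadratic polynomials $f\in(\mathbb{Z}/n\mathbb{Z})[x]$ that are liars for $n$ and satisfy $\left(\frac{\Delta}{n}\right)=-1$.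 *)

theory Defs
  imports "HOL-Number_Theory.Number_Theory" "HOL-Algebra.UnivPoly" "HOL-Algebra.Divisibility"
begin

text \<open>
  Polynomials over the integers modulo \<open>m\<close> are elements of the HOL-Algebra polynomial ring over
  the residue ring \<open>{0..m-1}\<close>; their coefficients are therefore integers in \<open>{0..m-1}\<close>.
\<close>

abbreviation Zmod :: "nat \<Rightarrow> int ring" where
  "Zmod m \<equiv> residue_ring (int m)"

abbreviation Zpoly :: "nat \<Rightarrow> (int, nat \<Rightarrow> int) up_ring" where
  "Zpoly m \<equiv> UP (Zmod m)"

definition Xpow :: "nat \<Rightarrow> nat \<Rightarrow> (nat \<Rightarrow> int)" where
  "Xpow m k = up_ring.monom (Zpoly m) \<one>\<^bsub>Zmod m\<^esub> k"

definition monic_poly :: "nat \<Rightarrow> (nat \<Rightarrow> int) \<Rightarrow> bool" where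
  "monic_poly m p \<longleftrightarrow>
     p \<in> carrier (Zpoly m) \<and> up_ring.coeff (Zpoly m) p (deg (Zmod m) p) = \<one>\<^bsub>Zmod m\<^esub>"

definition is_gcmd :: "nat \<Rightarrow> (nat \<Rightarrow> int) \<Rightarrow> (nat \<Rightarrow> int) \<Rightarrow> (nat \<Rightarrow> int) \<Rightarrow> bool" where
  "is_gcmd m g1 g2 h \<longleftrightarrow>
     monic_poly m g1 \<and> monic_poly m g2 \<and> monic_poly m h \<and>
     Idl\<^bsub>Zpoly m\<^esub> {g1, g2} = Idl\<^bsub>Zpoly m\<^esub> {h}"

text \<open>\<open>q = f / g\<close>; for monic \<open>g\<close> there is at most one such \<open>q\<close>.\<close>

definition is_quotient :: "nat \<Rightarrow> (nat \<Rightarrow> int) \<Rightarrow> (nat \<Rightarrow> int) \<Rightarrow> (nat \<Rightarrow> int) \<Rightarrow> bool" where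
  "is_quotient m f g q \<longleftrightarrow> q \<in> carrier (Zpoly m) \<and> f = g \<otimes>\<^bsub>Zpoly m\<^esub> q"

text \<open>\<open>p(x\<^sup>k)\<close>, by substitution of \<open>x\<^sup>k\<close> into \<open>p\<close>.\<close>

definition subst_Xpow :: "nat \<Rightarrow> nat \<Rightarrow> (nat \<Rightarrow> int) \<Rightarrow> (nat \<Rightarrow> int)" where
  "subst_Xpow m k p =
     eval (Zmod m) (Zpoly m) (\<lambda>a. up_ring.monom (Zpoly m) a 0) (Xpow m k) p"

definition monic_quadratics :: "nat \<Rightarrow> (nat \<Rightarrow> int) set" where
  "monic_quadratics m = {f. monic_poly m f \<and> deg (Zmod m) f = 2}"

text \<open>
  \<open>b\<^sup>2 - 4 c\<close> for \<open>f = x\<^sup>2 + b x + c\<close>, computed in the integers from the representatives of \<open>b\<close>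
  and \<open>c\<close> in \<open>{0..m-1}\<close>.
\<close>

definition disc2 :: "nat \<Rightarrow> (nat \<Rightarrow> int) \<Rightarrow> int" where
  "disc2 m f = (up_ring.coeff (Zpoly m) f 1)\<^sup>2 - 4 * up_ring.coeff (Zpoly m) f 0"

text \<open>
  The Jacobi symbol, multiplicative over the prime factorization of \<open>n\<close>. At the prime 2 we take
  the Kronecker symbol, so that the symbol is also defined for even \<open>n\<close>. If the discriminant is
  odd, it is congruent to 1 or 5 modulo 8 according to the parity of \<open>c\<close> alone, so in the presence
  of \<open>gcd(n, f(0) \<Delta>) = 1\<close> the symbol \<open>(\<Delta>/n)\<close> depends only on \<open>f\<close> modulo \<open>n\<close>, also for even \<open>n\<close>.
\<close>

definition local_symbol :: "int \<Rightarrow> nat \<Rightarrow> int" where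
  "local_symbol a p =
     (if p = 2 then (if even a then 0 else if a mod 8 = 1 \<or> a mod 8 = 7 then 1 else - 1)
      else Legendre a (int p))"

definition Jacobi :: "int \<Rightarrow> nat \<Rightarrow> int" where
  "Jacobi a n = (\<Prod>p\<in>prime_factors n. local_symbol a p ^ multiplicity p n)"

text \<open>
  The explicit evenness condition makes \<open>deg F2 / 2\<close> an integer, as the exponent of \<open>-1\<close> requires.
\<close>

definition frobenius_liar :: "nat \<Rightarrow> (nat \<Rightarrow> int) \<Rightarrow> bool" where
  "frobenius_liar n f \<longleftrightarrow>
     n > 1 \<and> \<not> Factorial_Ring.prime n \<and> f \<in> monic_quadratics n \<and>
     gcd (int n) (up_ring.coeff (Zpoly n) f 0 * disc2 n f) = 1 \<and>
     (\<exists>F1 f1 F2 f2.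
        is_gcmd n (Xpow n n \<ominus>\<^bsub>Zpoly n\<^esub> Xpow n 1) f F1 \<and>
        is_quotient n f F1 f1 \<and>
        is_gcmd n (Xpow n (n\<^sup>2) \<ominus>\<^bsub>Zpoly n\<^esub> Xpow n 1) f1 F2 \<and>
        is_quotient n f1 F2 f2 \<and>
        f2 = \<one>\<^bsub>Zpoly n\<^esub> \<and>
        F2 divides\<^bsub>Zpoly n\<^esub> subst_Xpow n n F2 \<and>
        even (deg (Zmod n) F2) \<and>
        (- 1) ^ (deg (Zmod n) F2 div 2) = Jacobi (disc2 n f) n)"

definition L2_minus :: "nat \<Rightarrow> nat" where
  "L2_minus n = card {f \<in> monic_quadratics n. frobenius_liar n f \<and> Jacobi (disc2 n f) n = - 1}"

definition C_term :: "nat \<Rightarrow> nat \<Rightarrow> real" where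
  "C_term n p =
     1 / 2 * (real (gcd (n\<^sup>2 - 1) (p - 1)) - real (gcd (n - 1) (p - 1)))"

definition D_term :: "nat \<Rightarrow> nat \<Rightarrow> real" where
  "D_term n p =
     1 / 2 * (real (gcd (gcd (p\<^sup>2 - 1) (n\<^sup>2 - 1)) (n - p)) - real (gcd (n - 1) (p - 1)))"

end

theory Submission
  imports Defs "HOL-Computational_Algebra.Polynomial"
begin

text \<open>
  If the discriminant of \<open>f = X\<^sup>2 + b X + c\<close> has symbol \<open>-1\<close>, then condition (4) forces
  \<open>F\<^sub>2 = f\<close>, and, since \<open>f(Y) = (Y - X) (Y + X + b)\<close> modulo \<open>f\<close>, the liar conditions
  collapse to \<open>X\<^sup>n = - b - X\<close> modulo \<open>f\<close> together with \<open>gcd(n, c (b\<^sup>2 - 4 c)) = 1\<close>. By the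
  Chinese remainder theorem such \<open>f\<close> are counted modulo each \<open>p\<^sup>r\<close>, separately for the two values
  of the symbol at \<open>p\<close>; half the difference of the plain and the sign-weighted count isolates the symbol \<open>-1\<close>.

  The solutions are fixed points of the map sending \<open>f\<close> to the characteristic polynomial of
  \<open>X\<^sup>n\<close>, that is, trace \<open>s\<close> and norm \<open>t\<close> to \<open>(V\<^sub>n(s, t), t\<^sup>n)\<close>. As \<open>p\<close> divides \<open>n\<close>, this map
  is a \<open>p\<close>-adic contraction, so every solution modulo \<open>p\<close> lifts uniquely modulo \<open>p\<^sup>r\<close>.
  Modulo \<open>p\<close> the roots of \<open>f\<close> are a pair \<open>a, a\<^sup>n\<close> in \<open>\<int>/p\<close>, counted by \<open>C\<close>, or a pair
  \<open>a, a\<^sup>p = a\<^sup>n\<close> in the field with \<open>p\<^sup>2\<close> elements, counted by \<open>D\<close>; both are counts of roots of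
  unity in a cyclic group.
\<close>

section \<open>Lucas sequences\<close>

text \<open>In terms of trace \<open>s\<close> and norm \<open>t\<close>,
  \<open>X^k = U_k X - t U_(k-1)\<close>, and \<open>V_k\<close> is the trace of \<open>X^k\<close>.
  The contraction comes from derivatives: those of \<open>V_n\<close> and of \<open>t^n\<close> all
  carry the factor \<open>n\<close>, hence a factor \<open>p\<close>. The obstacle is that trace and
  norm do not distinguish a root from its conjugate: \<open>X^n = X\<close> is a fixed point as
  well. The fixed-point equations give back \<open>X^n = - b - X\<close> only above a solution
  modulo \<open>p\<close>, where \<open>X^n - X\<close> is \<open>-(2 X + b)\<close> and so is
  invertible because the discriminant is a unit. Lifting is therefore carried out on the fixed-point
  equations, and the conjugation condition is recovered at the end. The coefficient ring modulo a
  composite \<open>n\<close> is not a domain. Polynomials are lifted to the integers, where degrees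
  add, and identities modulo \<open>f\<close> and \<open>m\<close> become membership in an ideal of
  integer polynomials. The symbol at \<open>p\<close> enters the Jacobi symbol with exponent
  \<open>r\<close>, so the inert count changes sign exactly for odd \<open>r\<close>. At
  \<open>p = 2\<close>, where halving is impossible, the only candidate is
  \<open>X^2 + X + 1\<close>, and it is treated by hand.\<close>

fun lucasU :: "int \<Rightarrow> int \<Rightarrow> nat \<Rightarrow> int" where
  "lucasU s t 0 = 0"
| "lucasU s t (Suc 0) = 1"
| "lucasU s t (Suc (Suc k)) = s * lucasU s t (Suc k) - t * lucasU s t k"

fun lucasV :: "int \<Rightarrow> int \<Rightarrow> nat \<Rightarrow> int" where
  "lucasV s t 0 = 2"
| "lucasV s t (Suc 0) = s"
| "lucasV s t (Suc (Suc k)) = s * lucasV s t (Suc k) - t * lucasV s t k"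

text \<open>The right-hand side is the trace of \<open>U_(k+1) X - t U_k\<close>, which is
  \<open>X^(k+1)\<close> modulo \<open>X^2 - s X + t\<close>.\<close>

lemma lucasV_eq: "lucasV s t (Suc k) = s * lucasU s t (Suc k) - 2 * t * lucasU s t k"
proof (induction s t k rule: lucasU.induct)
  case (3 s t k)
  have "lucasV s t (Suc (Suc (Suc k))) = s * lucasV s t (Suc (Suc k)) - t * lucasV s t (Suc k)"
    by (rule lucasV.simps)
  also have "\<dots> = s * lucasU s t (Suc (Suc (Suc k))) - 2 * t * lucasU s t (Suc (Suc k))"
    unfolding 3 by (simp add: algebra_simps)
  finally show ?case .
qed simp_all

text \<open>The left-hand side is the norm of \<open>U_(k+1) - U_k X\<close>, and this element is
  the \<open>k\<close>-th power of the conjugate of \<open>X\<close>.\<close>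

lemma lucasU_norm:
  "(lucasU s t (Suc k))\<^sup>2 - s * lucasU s t (Suc k) * lucasU s t k + t * (lucasU s t k)\<^sup>2 = t ^ k"
proof (induction k)
  case (Suc k)
  have "t ^ Suc k = t * ((lucasU s t (Suc k))\<^sup>2 - s * lucasU s t (Suc k) * lucasU s t k + t * (lucasU s t k)\<^sup>2)"
    using Suc by simp
  then show ?case by (simp add: power2_eq_square algebra_simps)
qed simp

lemma lucasU_cong:
  assumes "[s = s'] (mod m)" "[t = t'] (mod m)"
  shows "[lucasU s t k = lucasU s' t' k] (mod m)"
  using assms
  by (induction s t k rule: lucasU.induct) (auto intro!: cong_diff cong_mult)

text \<open>The first-order terms are the partial derivatives \<open>k U\<^sub>k\<close> and \<open>- k U\<^sub>k\<^sub>-\<^sub>1\<close> of \<open>V\<^sub>k\<close>.\<close>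

lemma lucasV_taylor:
  assumes "M dvd a" "M dvd e"
  shows "M\<^sup>2 dvd lucasV (s + a) (t + e) (Suc k) - lucasV s t (Suc k)
           - int (Suc k) * (a * lucasU s t (Suc k) - e * lucasU s t k)"
proof -
  \<comment> \<open>\<open>R\<close> is what is left of \<open>V_k\<close> after its linear part. It
    satisfies the Lucas recurrence with the shifted parameters, up to terms of second order in
    \<open>a\<close> and \<open>e\<close>, so divisibility by \<open>M^2\<close> propagates from two
    consecutive indices.\<close>
  define R where "R k = lucasV (s + a) (t + e) k - lucasV s t k
      - int k * (a * lucasU s t k - e * lucasU s t (k - 1))" for k
  obtain a' e' where a: "a = M * a'" and e: "e = M * e'"
    using assms by (auto elim!: dvdE)
  have rec: "R (Suc (Suc (Suc k))) = (s + a) * R (Suc (Suc k)) - (t + e) * R (Suc k)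
      + a * (int (Suc (Suc k)) * (a * lucasU s t (Suc (Suc k)) - e * lucasU s t (Suc k)))
      - e * (int (Suc k) * (a * lucasU s t (Suc k) - e * lucasU s t k))" for k
  proof -
    \<comment> \<open>The shift of the parameters leaves values of \<open>V\<close> multiplied by
      \<open>a\<close> and \<open>e\<close>; rewritten through \<open>U\<close> they become part of
      the second-order terms.\<close>
    have 1: "lucasV s t (Suc (Suc k)) = s * lucasU s t (Suc (Suc k)) - 2 * t * lucasU s t (Suc k)"
      by (rule lucasV_eq)
    have 2: "lucasV s t (Suc k) = s * lucasU s t (Suc k) - 2 * t * lucasU s t k"
      by (rule lucasV_eq)
    have "R (Suc (Suc (Suc k))) - ((s + a) * R (Suc (Suc k)) - (t + e) * R (Suc k)
      + a * (int (Suc (Suc k)) * (a * lucasU s t (Suc (Suc k)) - e * lucasU s t (Suc k)))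
      - e * (int (Suc k) * (a * lucasU s t (Suc k) - e * lucasU s t k))) = 0"
      unfolding R_def lucasV.simps(3)[of "s+a" "t+e" "Suc k"] lucasV.simps(3)[of s t "Suc k"] 1 2
      by (simp add: algebra_simps)
    then show ?thesis by simp
  qed
  have "M\<^sup>2 dvd R (Suc k) \<and> M\<^sup>2 dvd R (Suc (Suc k))"
  proof (induction k)
    case 0
    have "R (Suc (Suc 0)) = a * a"
      by (simp add: R_def algebra_simps)
    then show ?case by (simp add: R_def a power2_eq_square)
  next
    case (Suc k)
    have "M\<^sup>2 dvd a * (i * (a * x - e * y))" "M\<^sup>2 dvd e * (i * (a * x - e * y))" for i x y
      by (auto simp: a e power2_eq_square algebra_simps)
    with Suc show ?case unfolding rec by (meson dvd_add dvd_diff dvd_mult)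
  qed
  then show ?thesis by (simp add: R_def)
qed

text \<open>The linear Taylor term gains a factor \<open>p\<close> from \<open>n\<close>, and the
  remainder is divisible by \<open>p^(2k)\<close>, where \<open>2k >= k + 1\<close> because
  \<open>k > 0\<close>.\<close>

lemma cong_lucasV_lift:
  assumes "p dvd int n" "n > 0" "k > 0" "[s = s'] (mod p ^ k)" "[t = t'] (mod p ^ k)"
  shows "[lucasV s t n = lucasV s' t' n] (mod p ^ Suc k)"
proof -
  obtain j where n: "n = Suc j" using assms(2) gr0_implies_Suc by blast
  define a e where "a = s' - s" and "e = t' - t"
  have ae: "p ^ k dvd a" "p ^ k dvd e"
    using assms by (auto simp: a_def e_def cong_iff_dvd_diff dvd_diff_commute)
  have "p ^ Suc k dvd (p ^ k)\<^sup>2"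
    unfolding power_mult[symmetric] using assms(3) by (intro le_imp_power_dvd) simp
  then have 1: "p ^ Suc k dvd lucasV (s + a) (t + e) n - lucasV s t n
           - int n * (a * lucasU s t (Suc j) - e * lucasU s t j)"
    using lucasV_taylor[OF ae, of s t j] n dvd_trans by blast
  have "p ^ Suc k dvd int n * (a * lucasU s t (Suc j) - e * lucasU s t j)"
    unfolding power_Suc by (intro mult_dvd_mono dvd_diff dvd_mult2 ae assms)
  from dvd_add[OF 1 this] show ?thesis
    by (simp add: cong_iff_dvd_diff dvd_diff_commute a_def e_def)
qed

text \<open>The cofactor of \<open>t - t'\<close> in \<open>t^n - t'^n\<close> is congruent to
  \<open>n t'^(n-1)\<close> modulo \<open>p\<close>, which supplies the additional factor
  \<open>p\<close>.\<close>

lemma cong_power_lift: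
  fixes p t t' :: int
  assumes "p dvd int n" "k > 0" "[t = t'] (mod p ^ k)"
  shows "[t ^ n = t' ^ n] (mod p ^ Suc k)"
proof -
  have tp: "[t = t'] (mod p)" using assms(2,3)
    by (metis One_nat_def Suc_leI cong_dvd_modulus le_imp_power_dvd power_one_right)
  have eq: "t ^ n - t' ^ n = (t - t') * (\<Sum>i<n. t ^ (n - Suc i) * t' ^ i)"
    using power_diff_sumr2[of t' n t] by (simp add: algebra_simps)
  have "[(\<Sum>i<n. t ^ (n - Suc i) * t' ^ i) = (\<Sum>i<n. t' ^ (n - Suc i) * t' ^ i)] (mod p)"
    by (intro cong_sum cong_mult cong_pow tp cong_refl)
  also have "(\<Sum>i<n. t' ^ (n - Suc i) * t' ^ i) = int n * t' ^ (n - 1)"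
    by (simp flip: power_add)
  also have "[int n * t' ^ (n - 1) = 0] (mod p)" using assms(1) by (simp add: cong_0_iff)
  finally have "p dvd (\<Sum>i<n. t ^ (n - Suc i) * t' ^ i)" by (simp add: cong_0_iff)
  moreover have "p ^ k dvd t - t'" using assms(3) by (simp add: cong_iff_dvd_diff)
  ultimately have "p ^ Suc k dvd t ^ n - t' ^ n"
    unfolding eq power_Suc mult.commute[of p] by (intro mult_dvd_mono)
  then show ?thesis by (simp add: cong_iff_dvd_diff)
qed

text \<open>
  Modulo \<open>f = X\<^sup>2 + b X + c\<close> one has \<open>X\<^sup>n = U\<^sub>n X - c U\<^sub>n\<^sub>-\<^sub>1\<close> for the Lucas sequence
  with parameters \<open>-b\<close> and \<open>c\<close>, so this says that \<open>f\<close> divides \<open>X\<^sup>n + X + b\<close> modulo \<open>m\<close>.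
\<close>

definition conj_root :: "nat \<Rightarrow> int \<Rightarrow> int \<Rightarrow> int \<Rightarrow> bool" where
  "conj_root n m b c \<longleftrightarrow>
     m dvd lucasU (- b) c n + 1 \<and> m dvd c * lucasU (- b) c (n - 1) - b"

lemma conj_root_cong:
  assumes "[b = b'] (mod m)" "[c = c'] (mod m)"
  shows "conj_root n m b c \<longleftrightarrow> conj_root n m b' c'"
proof -
  have "[lucasU (- b) c k = lucasU (- b') c' k] (mod m)" for k
    by (intro lucasU_cong) (use assms in \<open>auto simp: cong_minus_minus_iff\<close>)
  then have "[lucasU (- b) c n + 1 = lucasU (- b') c' n + 1] (mod m)"
    "[c * lucasU (- b) c (n - 1) - b = c' * lucasU (- b') c' (n - 1) - b'] (mod m)"
    using assms by (auto intro!: cong_add cong_diff cong_mult)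
  then show ?thesis unfolding conj_root_def using cong_dvd_iff by blast
qed

lemma conj_root_dvd: "conj_root n m b c \<Longrightarrow> m' dvd m \<Longrightarrow> conj_root n m' b c"
  unfolding conj_root_def using dvd_trans by blast

text \<open>The conjugate of \<open>X\<close> has the trace and norm of \<open>X\<close>, namely
  \<open>-b\<close> and \<open>c\<close>, while \<open>X^n\<close> has trace \<open>V_n\<close> and
  norm \<open>c^n\<close>.\<close>

lemma conj_root_fixpoint:
  assumes "conj_root n m b c" "n > 0"
  shows "[lucasV (- b) c n = - b] (mod m)" "[c ^ n = c] (mod m)"
proof -
  obtain j where n: "n = Suc j" using assms(2) gr0_implies_Suc by blast
  obtain x y where x: "lucasU (- b) c n = m * x - 1" and y: "c * lucasU (- b) c j = m * y + b"
    using assms unfolding conj_root_def n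
    by (metis diff_Suc_1 diff_add_cancel add_diff_cancel_right' dvdE)
  have "lucasV (- b) c n = - b * lucasU (- b) c n - 2 * (c * lucasU (- b) c j)"
    unfolding n lucasV_eq by simp
  also have "\<dots> = - b + m * (- b * x - 2 * y)" unfolding x y by (simp add: algebra_simps)
  finally show "[lucasV (- b) c n = - b] (mod m)" by (simp add: cong_iff_dvd_diff)
  have "c ^ n = c * c ^ j" by (simp add: n)
  also have "\<dots> = c * (lucasU (- b) c n)\<^sup>2 + b * lucasU (- b) c n * (c * lucasU (- b) c j) + (c * lucasU (- b) c j)\<^sup>2"
    unfolding lucasU_norm[of "-b" c j, symmetric] n by (simp add: algebra_simps power2_eq_square)
  also have "\<dots> = c + m * (c * (m * x * x - 2 * x) + b * (m * x * y + b * x - y) + m * y * y + 2 * y * b)"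
    unfolding x y by (simp add: algebra_simps power2_eq_square)
  finally show "[c ^ n = c] (mod m)" by (simp add: cong_iff_dvd_diff)
qed

text \<open>
  With \<open>y = X\<^sup>n\<close> and \<open>x = X\<close> modulo \<open>f\<close>, the hypotheses on trace and norm give
  \<open>(y - x) (y + x + b) = 0\<close>, and the norm of \<open>y - x\<close> is a unit because \<open>y\<close> is the conjugate of
  \<open>x\<close> modulo \<open>p\<close>.
\<close>

lemma conj_rootI:
  fixes p :: int
  assumes p: "Factorial_Ring.prime p" "\<not> p dvd b\<^sup>2 - 4 * c" and n: "n > 0" and cr: "conj_root n p b c"
    and V: "[lucasV (- b) c n = - b] (mod p ^ r)" and N: "[c ^ n = c] (mod p ^ r)"
  shows "conj_root n (p ^ r) b c"
proof -
  obtain j where j: "n = Suc j" using n gr0_implies_Suc by blast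
  \<comment> \<open>Modulo \<open>f\<close>, \<open>X^n = u X + v\<close>; \<open>N0\<close> below
    is the norm of \<open>X^n - X = (u - 1) X + v\<close>.\<close>
  define u v where "u = lucasU (- b) c n" and "v = - c * lucasU (- b) c j"
  define m where "m = p ^ r"
  define N0 where "N0 = v\<^sup>2 - b * (u - 1) * v + c * (u - 1)\<^sup>2"
  have "lucasV (- b) c n = - b * u + 2 * v"
    unfolding j lucasV_eq u_def v_def by simp
  then have E1: "m dvd - b * u + 2 * v + b"
    using V by (simp add: cong_iff_dvd_diff m_def)
  have "c ^ n = v\<^sup>2 - b * u * v + c * u\<^sup>2"
    using lucasU_norm[of "-b" c j] unfolding j u_def v_def
    by (simp add: algebra_simps power2_eq_square flip: lucasU_norm[of "-b" c j])
  then have E2: "m dvd v\<^sup>2 - b * u * v + c * u\<^sup>2 - c"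
    using N by (simp add: cong_iff_dvd_diff m_def)
  \<comment> \<open>\<open>P\<close> and \<open>Q\<close> are the coefficients of \<open>X\<close>
    and \<open>1\<close> in \<open>f(X^n) = (X^n - X) (X^n + X + b)\<close> reduced modulo
    \<open>f\<close>.\<close>
  define P where "P = u * (- b * u + 2 * v + b)"
  define Q where "Q = v * (- b * u + 2 * v + b) - (v\<^sup>2 - b * u * v + c * u\<^sup>2 - c)"
  have PQ: "m dvd P" "m dvd Q" unfolding P_def Q_def using E1 E2 by auto
  \<comment> \<open>Multiplication by the conjugate of \<open>X^n - X\<close> turns that factor into
    \<open>N0\<close>; the other factor is \<open>(u + 1) X + (v + b)\<close>.\<close>
  have "N0 * (u + 1) = v * P - (u - 1) * Q"
       "N0 * (v + b) = (v - b * (u - 1)) * Q + c * (u - 1) * P"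
    unfolding N0_def P_def Q_def by (simp_all add: algebra_simps power2_eq_square)
  then have d: "m dvd N0 * (u + 1)" "m dvd N0 * (v + b)"
    using PQ by auto
  have up: "[u = - 1] (mod p)" and vp: "[v = - b] (mod p)"
    using cr unfolding conj_root_def u_def v_def j
    by (auto simp: cong_iff_dvd_diff algebra_simps dvd_diff_commute)
  \<comment> \<open>Modulo \<open>p\<close>, \<open>X^n - X\<close> is \<open>-(2 X + b)\<close>,
    whose norm is minus the discriminant.\<close>
  have "[N0 = (- b)\<^sup>2 - b * (- 1 - 1) * (- b) + c * (- 1 - 1)\<^sup>2] (mod p)"
    unfolding N0_def by (intro cong_add cong_diff cong_mult cong_pow up vp cong_refl)
  then have "[N0 = - (b\<^sup>2 - 4 * c)] (mod p)" by (simp add: power2_eq_square algebra_simps)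
  then have "\<not> p dvd N0" using p(2) cong_dvd_iff dvd_minus_iff by blast
  then have "coprime m N0" unfolding m_def using p(1)
    by (simp add: prime_imp_coprime)
  then have "m dvd u + 1" "m dvd v + b" using d coprime_dvd_mult_right_iff by blast+
  then have "m dvd - (v + b)" by (simp only: dvd_minus_iff)
  then show ?thesis using \<open>m dvd u + 1\<close> unfolding conj_root_def u_def v_def m_def j by simp
qed

section \<open>Reduction to primes\<close>

text \<open>An odd square is 1 and \<open>4 c\<close> is 4 modulo 8. Hence an admissible quadratic
  always has symbol \<open>-1\<close> at the prime 2.\<close>

lemma disc_mod_8_odd:
  fixes b c :: int
  assumes "odd c" "odd (b\<^sup>2 - 4 * c)"
  shows "(b\<^sup>2 - 4 * c) mod 8 = 5"
proof -
  have "odd b" using assms by simp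
  then obtain k where b: "b = 2 * k + 1" by (elim oddE)
  obtain l where c: "c = 2 * l + 1" using assms(1) by (elim oddE)
  have "even (k * (k + 1))" by simp
  then obtain j where j: "k * (k + 1) = 2 * j" by (elim evenE)
  have "b\<^sup>2 - 4 * c = 4 * (k * (k + 1)) + 1 - 4 * c"
    by (simp add: b power2_eq_square algebra_simps)
  also have "\<dots> = 5 + 8 * (j - l - 1)" unfolding j c by simp
  finally show ?thesis by (simp only: mod_mult_self2) simp
qed

text \<open>The delicate case is \<open>p = 2\<close>: the symbol depends on the discriminant modulo
  8, while \<open>b\<close> and \<open>c\<close> are known only modulo 2. Oddness of
  \<open>c\<close> and of the discriminant fixes the class 5.\<close>

lemma local_symbol_disc_cong:
  assumes "[b = b'] (mod int p)" "[c = c'] (mod int p)" "\<not> int p dvd c * (b\<^sup>2 - 4 * c)"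
  shows "local_symbol (b\<^sup>2 - 4 * c) p = local_symbol (b'\<^sup>2 - 4 * c') p"
proof -
  have d: "[b\<^sup>2 - 4 * c = b'\<^sup>2 - 4 * c'] (mod int p)"
    using assms by (intro cong_diff cong_pow cong_mult cong_refl) auto
  show ?thesis
  proof (cases "p = 2")
    case True
    have "\<not> int p dvd c' * (b'\<^sup>2 - 4 * c')"
      using assms cong_dvd_iff[OF cong_mult[OF assms(2) d]] by blast
    with True assms(3) have *: "odd c" "odd (b\<^sup>2 - 4 * c)" "odd c'" "odd (b'\<^sup>2 - 4 * c')"
      by (auto simp del: even_diff even_mult_iff simp: even_mult_iff)
    show ?thesis using disc_mod_8_odd[OF *(1,2)] disc_mod_8_odd[OF *(3,4)] *(2,4)
      by (simp add: local_symbol_def True)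
  next
    case False
    then show ?thesis using d unfolding local_symbol_def Legendre_def QuadRes_def cong_def
      by simp
  qed
qed

text \<open>Two moduli occur: the conjugation condition is imposed modulo \<open>m\<close>, which is
  \<open>p\<close> or a power of it, whereas the unit condition and the symbol are read at
  \<open>p\<close>. The exponent \<open>n\<close> stays the full composite number.\<close>

definition local_liars :: "nat \<Rightarrow> nat \<Rightarrow> nat \<Rightarrow> int \<Rightarrow> (int \<times> int) set" where
  "local_liars n p m \<sigma> = {(b, c). b \<in> {0..<int m} \<and> c \<in> {0..<int m} \<and>
     conj_root n (int m) b c \<and> \<not> int p dvd c * (b\<^sup>2 - 4 * c) \<and> local_symbol (b\<^sup>2 - 4 * c) p = \<sigma>}"

lemma finite_local_liars [simp]: "finite (local_liars n p m \<sigma>)"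
  by (rule finite_subset[of _ "{0..<int m} \<times> {0..<int m}"]) (auto simp: local_liars_def)

text \<open>Both pairs are fixed points of the contraction, so each application of it improves their
  agreement by one power of \<open>p\<close>.\<close>

lemma conj_root_lift_unique:
  fixes p :: int
  assumes p: "p dvd int n" and n: "n > 0" and k: "k < r"
    and cr: "conj_root n (p ^ r) b c" "conj_root n (p ^ r) b' c'"
    and eq: "[b = b'] (mod p)" "[c = c'] (mod p)"
  shows "[b = b'] (mod p ^ Suc k) \<and> [c = c'] (mod p ^ Suc k)"
  using k
proof (induction k)
  case (Suc k)
  then have IH: "[b = b'] (mod p ^ Suc k)" "[c = c'] (mod p ^ Suc k)" by auto
  have d: "p ^ Suc (Suc k) dvd p ^ r" using Suc.prems by (intro le_imp_power_dvd) simp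
  note fp = conj_root_fixpoint[OF conj_root_dvd[OF _ d] n]
  have "[- b = lucasV (- b) c n] (mod p ^ Suc (Suc k))"
    using fp(1)[OF cr(1)] by (rule cong_sym)
  also have "[lucasV (- b) c n = lucasV (- b') c' n] (mod p ^ Suc (Suc k))"
    by (rule cong_lucasV_lift[OF p n]) (use IH in \<open>auto simp: cong_minus_minus_iff\<close>)
  also have "[lucasV (- b') c' n = - b'] (mod p ^ Suc (Suc k))" by (rule fp(1)[OF cr(2)])
  finally have 1: "[b = b'] (mod p ^ Suc (Suc k))" by (simp add: cong_minus_minus_iff)
  have "[c = c ^ n] (mod p ^ Suc (Suc k))" using fp(2)[OF cr(1)] by (rule cong_sym)
  also have "[c ^ n = c' ^ n] (mod p ^ Suc (Suc k))"
    by (rule cong_power_lift[OF p]) (use IH in auto)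
  also have "[c' ^ n = c'] (mod p ^ Suc (Suc k))" by (rule fp(2)[OF cr(2)])
  finally show ?case using 1 by simp
qed (use eq in simp)

text \<open>Iterating the contraction from a solution modulo \<open>p\<close> yields fixed points
  modulo higher powers. The induction carries only the fixed-point equations;
  \<open>conj_rootI\<close> converts the final pair back.\<close>

lemma conj_root_lift_exists:
  fixes p :: int
  assumes p: "Factorial_Ring.prime p" "p dvd int n" and n: "n > 0"
    and cr: "conj_root n p b c" and D: "\<not> p dvd b\<^sup>2 - 4 * c"
  shows "\<exists>b' c'. [b' = b] (mod p) \<and> [c' = c] (mod p) \<and> conj_root n (p ^ Suc k) b' c'"
proof -
  have "\<exists>b' c'. [b' = b] (mod p) \<and> [c' = c] (mod p) \<and>
          [lucasV (- b') c' n = - b'] (mod p ^ Suc k) \<and> [c' ^ n = c'] (mod p ^ Suc k)"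
  proof (induction k)
    case 0
    show ?case using conj_root_fixpoint[OF cr n] by (intro exI[of _ b] exI[of _ c]) simp
  next
    case (Suc k)
    then obtain b' c' where *: "[b' = b] (mod p)" "[c' = c] (mod p)"
      "[lucasV (- b') c' n = - b'] (mod p ^ Suc k)" "[c' ^ n = c'] (mod p ^ Suc k)" by blast
    define b2 c2 where "b2 = - lucasV (- b') c' n" and "c2 = c' ^ n"
    have pd: "p dvd p ^ Suc k" by simp
    have b2: "[- b2 = - b'] (mod p ^ Suc k)" and c2: "[c2 = c'] (mod p ^ Suc k)"
      using * by (simp_all add: b2_def c2_def)
    have "[lucasV (- b2) c2 n = lucasV (- b') c' n] (mod p ^ Suc (Suc k))"
      by (rule cong_lucasV_lift[OF p(2) n _ b2 c2]) simp
    moreover have "[c2 ^ n = c' ^ n] (mod p ^ Suc (Suc k))"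
      by (rule cong_power_lift[OF p(2) _ c2]) simp
    moreover have "[b2 = b'] (mod p)" "[c2 = c'] (mod p)"
      using b2 c2 cong_dvd_modulus[OF _ pd] by (auto simp: cong_minus_minus_iff)
    ultimately show ?case using * cong_trans unfolding b2_def[symmetric] c2_def[symmetric]
      by (intro exI[of _ b2] exI[of _ c2]) (auto simp: b2_def c2_def intro: cong_trans)
  qed
  then obtain b' c' where *: "[b' = b] (mod p)" "[c' = c] (mod p)"
      "[lucasV (- b') c' n = - b'] (mod p ^ Suc k)" "[c' ^ n = c'] (mod p ^ Suc k)" by blast
  have "[b'\<^sup>2 - 4 * c' = b\<^sup>2 - 4 * c] (mod p)"
    using * by (intro cong_diff cong_pow cong_mult cong_refl) auto
  then have "\<not> p dvd b'\<^sup>2 - 4 * c'" using D cong_dvd_iff by blast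
  moreover have "conj_root n p b' c'" using conj_root_cong[OF *(1,2)] cr by blast
  ultimately show ?thesis using conj_rootI[OF p(1) _ n _ *(3,4)] * by blast
qed

text \<open>Reduction modulo \<open>p\<close> is a bijection: uniqueness of lifts gives injectivity,
  existence gives surjectivity. This is why the exponents \<open>r\<close> influence the formula
  only through signs.\<close>

lemma card_local_liars_prime_power:
  assumes p: "Factorial_Ring.prime p" "p dvd n" and n: "n > 0" and r: "r > 0"
  shows "card (local_liars n p (p ^ r) \<sigma>) = card (local_liars n p p \<sigma>)"
proof -
  define \<rho> where "\<rho> = (\<lambda>(b, c). (b mod int p, c mod int p))"
  have p': "Factorial_Ring.prime (int p)" "int p dvd int n" "int p > 0"
    using p prime_gt_0_nat by auto
  have pr: "int p dvd int p ^ r" using r by (simp add: dvd_power)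
  have mc: "[x mod int p = x] (mod int p)" for x by simp
  have Dmod: "int p dvd (c mod int p) * ((b mod int p)\<^sup>2 - 4 * (c mod int p)) \<longleftrightarrow>
      int p dvd c * (b\<^sup>2 - 4 * c)" for b c
    by (rule cong_dvd_iff) (intro cong_mult cong_diff cong_pow mc cong_refl)
  have "bij_betw \<rho> (local_liars n p (p ^ r) \<sigma>) (local_liars n p p \<sigma>)"
  proof (rule bij_betw_imageI)
    show "inj_on \<rho> (local_liars n p (p ^ r) \<sigma>)"
    proof (rule inj_onI, clarify)
      fix b c b' c'
      assume 1: "(b, c) \<in> local_liars n p (p ^ r) \<sigma>" and 2: "(b', c') \<in> local_liars n p (p ^ r) \<sigma>"
        and eq: "\<rho> (b, c) = \<rho> (b', c')"
      have cr: "conj_root n (int p ^ r) b c" "conj_root n (int p ^ r) b' c'"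
        using 1 2 by (auto simp: local_liars_def)
      have "[b = b'] (mod int p)" "[c = c'] (mod int p)"
        using eq by (auto simp: \<rho>_def cong_def)
      from conj_root_lift_unique[OF p'(2) n _ cr this, of "r - 1"] r
      have "[b = b'] (mod int p ^ r)" "[c = c'] (mod int p ^ r)" by auto
      then show "b = b' \<and> c = c'"
        using 1 2 by (auto simp: local_liars_def cong_def)
    qed
    show "\<rho> ` local_liars n p (p ^ r) \<sigma> = local_liars n p p \<sigma>"
    proof (intro equalityI subsetI)
      fix x assume "x \<in> \<rho> ` local_liars n p (p ^ r) \<sigma>"
      then obtain b c where x: "x = \<rho> (b, c)" and bc: "(b, c) \<in> local_liars n p (p ^ r) \<sigma>" by auto
      have "conj_root n (int p) b c"
        using bc conj_root_dvd[OF _ pr] by (auto simp: local_liars_def)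
      then have "conj_root n (int p) (b mod int p) (c mod int p)"
        using conj_root_cong[OF mc mc] by blast
      moreover have nd: "\<not> int p dvd c * (b\<^sup>2 - 4 * c)"
        using bc by (auto simp: local_liars_def)
      moreover have "local_symbol ((b mod int p)\<^sup>2 - 4 * (c mod int p)) p = \<sigma>"
        using bc local_symbol_disc_cong[of "b mod int p" b p "c mod int p" c] Dmod[of c b] nd mc
        by (auto simp: local_liars_def)
      ultimately show "x \<in> local_liars n p p \<sigma>"
        using p'(3) by (simp add: x \<rho>_def local_liars_def Dmod)
    next
      fix x assume "x \<in> local_liars n p p \<sigma>"
      then obtain b c where x: "x = (b, c)" and bc: "b \<in> {0..<int p}" "c \<in> {0..<int p}"
        "conj_root n (int p) b c" "\<not> int p dvd c * (b\<^sup>2 - 4 * c)" "local_symbol (b\<^sup>2 - 4 * c) p = \<sigma>"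
        unfolding local_liars_def by auto
      have "\<not> int p dvd b\<^sup>2 - 4 * c" using bc(4) by auto
      from conj_root_lift_exists[OF p'(1,2) n bc(3) this, of "r - 1"] r
      obtain b' c' where *: "[b' = b] (mod int p)" "[c' = c] (mod int p)"
        "conj_root n (int p ^ r) b' c'" by auto
      define b2 c2 where "b2 = b' mod int p ^ r" and "c2 = c' mod int p ^ r"
      have m: "[b2 = b'] (mod int p ^ r)" "[c2 = c'] (mod int p ^ r)"
        by (simp_all add: b2_def c2_def)
      have cr2: "conj_root n (int p ^ r) b2 c2"
        using conj_root_cong[OF m] *(3) by blast
      have m': "[b2 = b] (mod int p)" "[c2 = c] (mod int p)"
        using m cong_dvd_modulus[OF _ pr] *(1,2) cong_trans by blast+
      have "[c2 * (b2\<^sup>2 - 4 * c2) = c * (b\<^sup>2 - 4 * c)] (mod int p)"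
        by (intro cong_mult cong_diff cong_pow m' cong_refl)
      then have nd2: "\<not> int p dvd c2 * (b2\<^sup>2 - 4 * c2)" using bc(4) cong_dvd_iff by blast
      have "(b2, c2) \<in> local_liars n p (p ^ r) \<sigma>"
        using cr2 nd2 local_symbol_disc_cong[OF m' nd2] bc(5) p'(3)
        by (simp add: local_liars_def b2_def c2_def)
      moreover have "\<rho> (b2, c2) = x" using m' bc(1,2) by (simp add: \<rho>_def x cong_def)
      ultimately show "x \<in> \<rho> ` local_liars n p (p ^ r) \<sigma>" by (metis imageI)
    qed
  qed
  then show ?thesis by (rule bij_betw_same_card)
qed

section \<open>The Chinese remainder theorem for weighted sums over pairs of residues\<close>

lemma sum_mod_mult_coprime:
  fixes F G :: "int \<Rightarrow> int \<Rightarrow> real" and m1 m2 :: nat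
  assumes "coprime m1 m2" "m1 > 0" "m2 > 0"
    and F: "\<And>b c. F (b mod int m1) (c mod int m1) = F b c"
    and G: "\<And>b c. G (b mod int m2) (c mod int m2) = G b c"
  shows "(\<Sum>(b, c)\<in>{0..<int (m1 * m2)} \<times> {0..<int (m1 * m2)}. F b c * G b c) =
    (\<Sum>(b, c)\<in>{0..<int m1} \<times> {0..<int m1}. F b c) * (\<Sum>(b, c)\<in>{0..<int m2} \<times> {0..<int m2}. G b c)"
proof -
  let ?S = "\<lambda>m::nat. {0..<int m} \<times> {0..<int m}"
  define h where "h = (\<lambda>(b, c). ((b mod int m1, c mod int m1), (b mod int m2, c mod int m2)))"
  have cp: "coprime (int m1) (int m2)" using assms(1) by simp
  have "bij_betw h (?S (m1 * m2)) (?S m1 \<times> ?S m2)"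
  proof (rule bij_betw_imageI)
    have *: "x = y" if "x mod int m1 = y mod int m1" "x mod int m2 = y mod int m2"
      "0 \<le> x" "x < int m1 * int m2" "0 \<le> y" "y < int m1 * int m2" for x y
      using coprime_cong_mult[of x y "int m1" "int m2"] that cp by (auto simp: cong_def)
    show "inj_on h (?S (m1 * m2))"
      by (rule inj_onI) (auto simp: h_def intro: *)
    have **: "\<exists>x. 0 \<le> x \<and> x < int m1 * int m2 \<and> x mod int m1 = u \<and> x mod int m2 = v"
      if "0 \<le> u" "u < int m1" "0 \<le> v" "v < int m2" for u v
    proof -
      obtain x where x: "[x = u] (mod int m1)" "[x = v] (mod int m2)"
        using binary_chinese_remainder_int[OF cp] by blast
      then show ?thesis using assms(2,3) that
        by (intro exI[of _ "x mod (int m1 * int m2)"]) (simp add: cong_def mod_mod_cancel)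
    qed
    show "h ` ?S (m1 * m2) = ?S m1 \<times> ?S m2"
    proof (intro equalityI subsetI)
      fix x assume "x \<in> ?S m1 \<times> ?S m2"
      then obtain u u' v v' where x: "x = ((u, u'), (v, v'))"
        and r: "0 \<le> u" "u < int m1" "0 \<le> v" "v < int m2" "0 \<le> u'" "u' < int m1" "0 \<le> v'" "v' < int m2"
        by auto
      obtain b where b: "0 \<le> b \<and> b < int m1 * int m2 \<and> b mod int m1 = u \<and> b mod int m2 = v"
        using **[OF r(1-4)] by blast
      obtain c where c: "0 \<le> c \<and> c < int m1 * int m2 \<and> c mod int m1 = u' \<and> c mod int m2 = v'"
        using **[OF r(5-8)] by blast
      show "x \<in> h ` ?S (m1 * m2)"
        using b c by (intro image_eqI[of _ _ "(b, c)"]) (auto simp: x h_def)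
    qed (use assms(2,3) in \<open>auto simp: h_def\<close>)
  qed
  then have "(\<Sum>((b, c), (b', c'))\<in>?S m1 \<times> ?S m2. F b c * G b' c') =
      (\<Sum>x\<in>?S (m1 * m2). case h x of ((b, c), (b', c')) \<Rightarrow> F b c * G b' c')"
    using sum.reindex_bij_betw[of h _ _ "\<lambda>x. F (fst (fst x)) (snd (fst x)) * G (fst (snd x)) (snd (snd x))"]
    by (simp add: case_prod_unfold)
  also have "\<dots> = (\<Sum>(b, c)\<in>?S (m1 * m2). F b c * G b c)"
    by (rule sum.cong) (auto simp: h_def F G)
  finally show ?thesis
    by (simp add: sum_product sum.cartesian_product case_prod_unfold)
qed

text \<open>Each factor depends only on the residues modulo its own prime power, so one prime at a
  time can be split off. Real weights cover both the plain and the signed count.\<close>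

lemma sum_prod_prime_powers:
  fixes F :: "nat \<Rightarrow> int \<Rightarrow> int \<Rightarrow> real" and e :: "nat \<Rightarrow> nat"
  assumes "finite A" "\<And>p. p \<in> A \<Longrightarrow> Factorial_Ring.prime p"
    and F: "\<And>p b c b' c'. p \<in> A \<Longrightarrow> [b = b'] (mod int (p ^ e p)) \<Longrightarrow> [c = c'] (mod int (p ^ e p))
              \<Longrightarrow> F p b c = F p b' c'"
  shows "(\<Sum>(b, c)\<in>{0..<int (\<Prod>p\<in>A. p ^ e p)} \<times> {0..<int (\<Prod>p\<in>A. p ^ e p)}. \<Prod>p\<in>A. F p b c) =
    (\<Prod>p\<in>A. \<Sum>(b, c)\<in>{0..<int (p ^ e p)} \<times> {0..<int (p ^ e p)}. F p b c)"
  using assms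
proof (induction A rule: finite_induct)
  case empty
  have "{0..<1::int} = {0}" by auto
  then show ?case by simp
next
  case (insert q A)
  define Q where "Q = (\<Prod>p\<in>A. p ^ e p)"
  have cp: "coprime (q ^ e q) Q" unfolding Q_def
    using insert by (intro prod_coprime_right) (metis coprime_power_left_iff coprime_power_right_iff insertCI primes_coprime)
  have pos: "q ^ e q > 0" "Q > 0"
    using insert.prems(1) by (auto simp: Q_def prime_gt_0_nat intro!: prod_pos)
  have dQ: "int (p ^ e p) dvd int Q" if "p \<in> A" for p
    unfolding Q_def of_nat_dvd_iff using insert.hyps that by (intro dvd_prodI)
  have "(\<Sum>(b, c)\<in>{0..<int (q ^ e q * Q)} \<times> {0..<int (q ^ e q * Q)}. F q b c * (\<Prod>p\<in>A. F p b c)) =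
    (\<Sum>(b, c)\<in>{0..<int (q ^ e q)} \<times> {0..<int (q ^ e q)}. F q b c) *
    (\<Sum>(b, c)\<in>{0..<int Q} \<times> {0..<int Q}. \<Prod>p\<in>A. F p b c)"
  proof (rule sum_mod_mult_coprime[OF cp pos])
    show "F q (b mod int (q ^ e q)) (c mod int (q ^ e q)) = F q b c" for b c
      by (rule insert.prems(2)) auto
    show "(\<Prod>p\<in>A. F p (b mod int Q) (c mod int Q)) = (\<Prod>p\<in>A. F p b c)" for b c
    proof (rule prod.cong[OF refl])
      fix p assume "p \<in> A"
      then show "F p (b mod int Q) (c mod int Q) = F p b c"
        using dQ by (intro insert.prems(2)) (auto intro: cong_dvd_modulus[of _ _ "int Q"])
    qed
  qed
  also have "(\<Sum>(b, c)\<in>{0..<int Q} \<times> {0..<int Q}. \<Prod>p\<in>A. F p b c) =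
     (\<Prod>p\<in>A. \<Sum>(b, c)\<in>{0..<int (p ^ e p)} \<times> {0..<int (p ^ e p)}. F p b c)"
    unfolding Q_def using insert.prems by (intro insert.IH) auto
  finally show ?case using insert.hyps by (simp add: Q_def)
qed

section \<open>Powers of the indeterminate modulo a quadratic\<close>

definition quad :: "int \<Rightarrow> int \<Rightarrow> int poly" where
  "quad b c = [:c, b, 1:]"

lemma degree_quad [simp]: "degree (quad b c) = 2"
  and lead_coeff_quad: "lead_coeff (quad b c) = 1"
  by (simp_all add: quad_def)

text \<open>Horner's scheme: after multiplication of the remainder \<open>x + y X\<close> by
  \<open>X\<close>, the term \<open>y X^2\<close> is replaced by
  \<open>y f - b y X - c y\<close>.\<close>

lemma quad_division: "\<exists>q x y. P = quad b c * q + [:x, y:]"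
proof (induction P)
  case (pCons a P)
  then obtain q x y where P: "P = quad b c * q + [:x, y:]" by blast
  have "pCons a P = quad b c * (pCons y q) + [:a - c * y, x - b * y:]"
    unfolding P by (simp add: quad_def algebra_simps)
  then show ?case by blast
next
  case 0
  have "0 = quad b c * 0 + [:0, 0:]" by simp
  then show ?case by blast
qed

lemma linear_eq_quad_mult: "[:x, y:] = quad b c * q \<Longrightarrow> x = 0 \<and> y = 0"
proof (rule ccontr)
  assume eq: "[:x, y:] = quad b c * q" and "\<not> (x = 0 \<and> y = 0)"
  then have "q \<noteq> 0" "quad b c \<noteq> 0" by (auto simp: quad_def)
  then have "degree [:x, y:] = 2 + degree q" unfolding eq by (simp add: degree_mult_eq)
  moreover have "degree [:x, y:] \<le> 1" by simp
  ultimately show False by linarith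
qed

lemma monom_mod_quad:
  "\<exists>q. monom 1 (Suc k) = quad b c * q + [:- c * lucasU (- b) c k, lucasU (- b) c (Suc k):]"
proof (induction k)
  case 0
  show ?case by (intro exI[of _ 0]) (simp add: monom_altdef)
next
  case (Suc k)
  then obtain q where q: "monom 1 (Suc k) = quad b c * q + [:- c * lucasU (- b) c k, lucasU (- b) c (Suc k):]"
    by blast
  have "monom 1 (Suc (Suc k)) = pCons 0 (monom (1::int) (Suc k))" by (simp add: monom_Suc)
  also have "\<dots> = quad b c * (pCons (lucasU (- b) c (Suc k)) q) +
      [:- c * lucasU (- b) c (Suc k), lucasU (- b) c (Suc (Suc k)):]"
    unfolding q by (simp add: quad_def algebra_simps)
  finally show ?case by blast
qed

text \<open>Membership in the ideal of integer polynomials generated by \<open>m\<close> and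
  \<open>f\<close>, that is, being zero in the residue ring modulo \<open>m\<close> and
  \<open>f\<close>. Over the integers ordinary polynomial identities apply directly.\<close>

definition vanishes :: "int \<Rightarrow> int \<Rightarrow> int \<Rightarrow> int poly \<Rightarrow> bool" where
  "vanishes m b c P \<longleftrightarrow> (\<exists>q r. P = quad b c * q + smult m r)"

lemma vanishes_add: "vanishes m b c P \<Longrightarrow> vanishes m b c Q \<Longrightarrow> vanishes m b c (P + Q)"
proof -
  assume "vanishes m b c P" "vanishes m b c Q"
  then obtain q r q' r' where "P = quad b c * q + smult m r" "Q = quad b c * q' + smult m r'"
    unfolding vanishes_def by blast
  then have "P + Q = quad b c * (q + q') + smult m (r + r')"
    by (simp add: distrib_left smult_add_right)
  then show ?thesis unfolding vanishes_def by blast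
qed

lemma vanishes_mult: "vanishes m b c P \<Longrightarrow> vanishes m b c (P * Q)"
proof -
  assume "vanishes m b c P"
  then obtain q r where "P = quad b c * q + smult m r"
    unfolding vanishes_def by blast
  then have "P * Q = quad b c * (q * Q) + smult m (r * Q)"
    by (simp add: distrib_right mult.assoc)
  then show ?thesis unfolding vanishes_def by blast
qed

lemma vanishes_mult_left: "vanishes m b c P \<Longrightarrow> vanishes m b c (Q * P)"
  using vanishes_mult[of m b c P Q] by (simp add: mult.commute)

lemma vanishes_minus: "vanishes m b c P \<Longrightarrow> vanishes m b c (- P)"
  using vanishes_mult[of m b c P "- 1"] by simp

lemma vanishes_diff: "vanishes m b c P \<Longrightarrow> vanishes m b c Q \<Longrightarrow> vanishes m b c (P - Q)"
  using vanishes_add[of m b c P "- Q"] vanishes_minus[of m b c Q] by simp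

lemma vanishes_quad: "vanishes m b c (quad b c)"
  unfolding vanishes_def by (intro exI[of _ 1] exI[of _ 0]) simp

lemma vanishes_smult: "vanishes m b c (smult m P)"
  unfolding vanishes_def by (intro exI[of _ 0] exI[of _ P]) simp

lemma vanishes_dvd: "P dvd Q \<Longrightarrow> vanishes m b c P \<Longrightarrow> vanishes m b c Q"
  by (auto elim!: dvdE intro: vanishes_mult)

text \<open>\<open>1\<close> and \<open>X\<close> form a basis modulo the monic \<open>f\<close>.
  Dividing the cofactor \<open>r\<close> of \<open>m\<close> by \<open>f\<close> makes the linear
  remainders comparable.\<close>

lemma vanishes_linear: "vanishes m b c [:x, y:] \<longleftrightarrow> m dvd x \<and> m dvd y"
proof
  assume "vanishes m b c [:x, y:]"
  then obtain q r where 1: "[:x, y:] = quad b c * q + smult m r" by (auto simp: vanishes_def)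
  obtain q' u v where 2: "r = quad b c * q' + [:u, v:]" using quad_division by blast
  have "[:x - m * u, y - m * v:] = [:x, y:] - smult m [:u, v:]" by simp
  also have "\<dots> = quad b c * (q + smult m q')"
    unfolding 1 by (simp add: 2 smult_add_right distrib_left)
  finally have "x - m * u = 0 \<and> y - m * v = 0" by (rule linear_eq_quad_mult)
  then show "m dvd x \<and> m dvd y" by auto
next
  assume "m dvd x \<and> m dvd y"
  then obtain u v where "x = m * u" "y = m * v" by (auto elim!: dvdE)
  then show "vanishes m b c [:x, y:]" using vanishes_smult[of m b c "[:u, v:]"] by simp
qed

lemma conj_root_iff_vanishes:
  assumes "n > 0"
  shows "conj_root n m b c \<longleftrightarrow> vanishes m b c (monom 1 n + [:b, 1:])"
proof -
  obtain k where n: "n = Suc k" using assms gr0_implies_Suc by blast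
  obtain q where q: "monom 1 n = quad b c * q + [:- c * lucasU (- b) c k, lucasU (- b) c n:]"
    using monom_mod_quad n by blast
  define R where "R = [:- (c * lucasU (- b) c k - b), lucasU (- b) c n + 1:]"
  have eq: "monom 1 n + [:b, 1:] = quad b c * q + R" unfolding q R_def by simp
  have v: "vanishes m b c (quad b c * q)" by (intro vanishes_mult vanishes_quad)
  have "vanishes m b c (monom 1 n + [:b, 1:]) \<longleftrightarrow> vanishes m b c R"
    using vanishes_add[OF v, of R] vanishes_diff[OF _ v, of "quad b c * q + R"] unfolding eq by auto
  also have "\<dots> \<longleftrightarrow> conj_root n m b c"
    unfolding R_def vanishes_linear conj_root_def n by (auto simp: dvd_diff_commute)
  finally show ?thesis ..
qed

text \<open>Formulated as divisibility in an arbitrary commutative ring, since it is applied both to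
  integers and to integer polynomials.\<close>

lemma prime_dvd_freshman:
  fixes a b :: "'a :: comm_ring_1"
  assumes "Factorial_Ring.prime p"
  shows "of_nat p dvd (a + b) ^ p - a ^ p - b ^ p"
proof -
  have p: "p > 0" using assms prime_gt_0_nat by blast
  have "(a + b) ^ p = (\<Sum>k\<le>p. of_nat (p choose k) * a ^ k * b ^ (p - k))"
    by (rule binomial_ring)
  also have "{..p} = insert 0 (insert p {0<..<p})" by auto
  also have "(\<Sum>k\<in>\<dots>. of_nat (p choose k) * a ^ k * b ^ (p - k)) =
      b ^ p + (a ^ p + (\<Sum>k\<in>{0<..<p}. of_nat (p choose k) * a ^ k * b ^ (p - k)))"
    using p by simp
  finally have "(a + b) ^ p - a ^ p - b ^ p = (\<Sum>k\<in>{0<..<p}. of_nat (p choose k) * a ^ k * b ^ (p - k))"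
    by simp
  moreover have "of_nat p dvd (of_nat (p choose k) * a ^ k * b ^ (p - k) :: 'a)" if "k \<in> {0<..<p}" for k
  proof -
    have "p dvd p choose k" using that assms by (intro dvd_choose_prime) auto
    then obtain j where "p choose k = p * j" by (rule dvdE)
    then show ?thesis by (simp add: mult.assoc)
  qed
  ultimately show ?thesis by (metis (no_types, lifting) dvd_sum)
qed

lemma fermat_int:
  fixes a :: int
  assumes "Factorial_Ring.prime p"
  shows "int p dvd a ^ p - a"
proof -
  have p: "p > 0" using assms prime_gt_0_nat by blast
  have step: "int p dvd (a + 1) ^ p - (a + 1) \<longleftrightarrow> int p dvd a ^ p - a" for a
  proof -
    have "int p dvd ((a + 1) ^ p - (a + 1)) - (a ^ p - a)"
      using prime_dvd_freshman[OF assms, of a 1] by (simp add: algebra_simps)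
    then have "[(a + 1) ^ p - (a + 1) = a ^ p - a] (mod int p)" by (simp add: cong_iff_dvd_diff)
    then show ?thesis by (rule cong_dvd_iff)
  qed
  show ?thesis
  proof (induction a rule: int_induct[of _ 0])
    case base
    show ?case using p by (simp add: power_0_left)
  next
    case (step1 i)
    then show ?case using step by simp
  next
    case (step2 i)
    then show ?case using step[of "i - 1"] by simp
  qed
qed

text \<open>With \<open>W = 2 X + b\<close> one has \<open>W\<^sup>2 = b\<^sup>2 - 4 c\<close>, so \<open>W\<^sup>p = - W\<close> by Euler's criterion.\<close>

lemma conj_root_nonresidue:
  assumes p: "Factorial_Ring.prime p" "p > 2" and D: "Legendre (b\<^sup>2 - 4 * c) (int p) = - 1"
  shows "conj_root p (int p) b c"
proof -
  define D0 where "D0 = b\<^sup>2 - 4 * c"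
  define e where "e = (p - 1) div 2"
  have pe: "p = Suc (2 * e)" using p prime_odd_nat[of p] by (auto simp: e_def elim!: oddE)
  let ?v = "vanishes (int p) b c"
  define X where "X = monom (1::int) 1"
  define W where "W = [:b, 2:]"
  have const: "?v [:a:]" if "int p dvd a" for a
    using vanishes_linear[of "int p" b c a 0] that by simp
  have W2: "W\<^sup>2 - [:D0:] = quad b c * [:4:]"
    by (simp add: W_def D0_def quad_def power2_eq_square algebra_simps)
  have "?v (W\<^sup>2 - [:D0:])" unfolding W2 by (intro vanishes_mult vanishes_quad)
  moreover have "W\<^sup>2 - [:D0:] dvd (W\<^sup>2) ^ e - [:D0:] ^ e"
    by (simp add: power_diff_sumr2)
  ultimately have "?v ((W\<^sup>2) ^ e - [:D0:] ^ e)" by (rule vanishes_dvd[rotated])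
  moreover have "[D0 ^ e = - 1] (mod int p)"
    using cong_sym[OF euler_criterion[OF p, of D0]] D by (simp add: D0_def e_def)
  then have "int p dvd D0 ^ e - (- 1)" unfolding cong_iff_dvd_diff .
  then have "?v [:D0 ^ e + 1:]" by (intro const) simp
  moreover have "[:D0:] ^ e = [:D0 ^ e:]" by (induction e) (simp_all add: mult.commute)
  ultimately have "?v ((W\<^sup>2) ^ e - [:D0:] ^ e + [:D0 ^ e + 1:])" by (intro vanishes_add)
  moreover have D1: "[:D0 ^ e + 1:] = [:D0 ^ e:] + 1" by (simp add: one_pCons)
  ultimately have "?v (((W\<^sup>2) ^ e + 1) * W)" using \<open>[:D0:] ^ e = [:D0 ^ e:]\<close>
    by (intro vanishes_mult) (simp add: D1)
  moreover have "((W\<^sup>2) ^ e + 1) * W = W ^ p + W"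
    unfolding pe power_Suc2 power_mult by (simp only: distrib_right mult_1_left)
  ultimately have 1: "?v (W ^ p + W)" by simp
  \<comment> \<open>The binomial theorem and Fermat reduce \<open>W^p\<close> to
    \<open>2 X^p + b\<close>, so that \<open>W^p + W\<close> becomes
    \<open>2 (X^p + X + b)\<close>.\<close>
  have W: "W = [:2:] * X + [:b:]" by (simp add: W_def X_def monom_altdef)
  have "of_nat p dvd W ^ p - ([:2:] * X) ^ p - [:b:] ^ p"
    unfolding W by (rule prime_dvd_freshman[OF p(1)])
  moreover have "?v (of_nat p)"
    using const[of "int p"] by (simp add: of_nat_poly)
  ultimately have 2: "?v (W ^ p - ([:2:] * X) ^ p - [:b:] ^ p)" by (rule vanishes_dvd)
  have pw: "[:a:] ^ k = [:a ^ k:]" for a :: int and k by (induction k) (simp_all add: mult.commute)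
  have 3: "?v [:b ^ p - b:]" "?v ([:2 ^ p - 2:] * X ^ p)"
    using const[OF fermat_int[OF p(1)]] vanishes_mult[OF const[OF fermat_int[OF p(1)]]] by auto
  have "?v ((W ^ p + W) - (W ^ p - ([:2:] * X) ^ p - [:b:] ^ p) - [:b ^ p - b:] - [:2 ^ p - 2:] * X ^ p)"
    by (intro vanishes_diff 1 2 3)
  also have "(W ^ p + W) - (W ^ p - ([:2:] * X) ^ p - [:b:] ^ p) - [:b ^ p - b:] - [:2 ^ p - 2:] * X ^ p
      = [:2:] * (monom 1 p + [:b, 1:])"
  proof -
    have "([:2:] * X) ^ p = [:2 ^ p:] * X ^ p" by (simp only: power_mult_distrib pw)
    moreover have "[:b ^ p - b:] = [:b ^ p:] - [:b:]" "[:2 ^ p - 2:] = [:2 ^ p:] - [:2::int:]" by simp_all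
    moreover have "[:2:] * [:b, 1:] = W + [:b:]" by (simp add: W_def)
    moreover have "monom 1 p = X ^ p" by (simp add: X_def monom_power)
    moreover have "(Wp + W) - (Wp - A * Y - B) - (B - C) - (A - T) * Y = T * Y + (W + C)"
      for Wp W A B C T Y :: "int poly" by (simp add: algebra_simps)
    ultimately show ?thesis by (simp only: pw distrib_left)
  qed
  \<comment> \<open>\<open>e + 1 = (p + 1) / 2\<close> inverts 2 modulo \<open>p\<close>:
    \<open>2 (e + 1) - p = 1\<close>.\<close>
  finally have "?v ([:int (Suc e):] * ([:2:] * (monom 1 p + [:b, 1:])))" by (rule vanishes_mult_left)
  then have "?v ([:int (Suc e):] * ([:2:] * (monom 1 p + [:b, 1:])) - smult (int p) (monom 1 p + [:b, 1:]))"
    using vanishes_smult by (rule vanishes_diff)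
  also have "[:int (Suc e):] * ([:2:] * (monom 1 p + [:b, 1:])) - smult (int p) (monom 1 p + [:b, 1:])
     = monom 1 p + [:b, 1:]"
  proof -
    have "[:x:] * ([:y:] * Q) - smult z Q = smult (x * y - z) Q" for x y z :: int and Q
      by (simp add: smult_diff_left mult.commute[of y])
    moreover have "int (Suc e) * 2 - int p = 1" by (simp add: pe)
    ultimately show ?thesis by (simp only: smult_1_left)
  qed
  finally show ?thesis using conj_root_iff_vanishes[of p] pe by simp
qed

section \<open>Split quadratics modulo a prime\<close>

lemma card_two_to_one:
  assumes "finite A" "finite B" "f ` A \<subseteq> B" "\<And>y. y \<in> B \<Longrightarrow> card {x \<in> A. f x = y} = 2"
  shows "card A = 2 * card B"
proof -
  have "card A = (\<Sum>y\<in>B. \<Sum>x\<in>{x \<in> A. f x = y}. 1)"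
    using sum.group[OF assms(1-3), of "\<lambda>_. 1::nat"] by simp
  also have "\<dots> = (\<Sum>y\<in>B. 2)" using assms(4) by (intro sum.cong) auto
  finally show ?thesis by simp
qed

text \<open>After division by the gcd, \<open>N\<close> and \<open>d\<close> become coprime, so the
  condition says that \<open>i\<close> is a multiple of \<open>N / gcd d N\<close>. Here
  \<open>i\<close> will be an exponent in a cyclic group of order \<open>N\<close>.\<close>

lemma card_mult_dvd:
  fixes N d :: nat
  assumes "N > 0"
  shows "card {i. i < N \<and> N dvd i * d} = gcd d N"
proof -
  define g where "g = gcd d N"
  define M where "M = N div g"
  have g: "g > 0" and N: "N = M * g" and M: "M > 0"
    using assms by (auto simp: g_def M_def div_greater_zero_iff gcd_le2_nat)
  obtain e where d: "d = g * e" unfolding g_def by (metis dvdE gcd_dvd1)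
  have "coprime M e"
  proof -
    have "e = d div gcd d N" using d g unfolding g_def by (metis nonzero_mult_div_cancel_left less_numeral_extra(3))
    then show ?thesis unfolding M_def g_def using assms div_gcd_coprime[of N d]
      by (simp add: gcd.commute)
  qed
  then have "N dvd i * d \<longleftrightarrow> M dvd i" for i
    using g by (simp add: N d mult.assoc[symmetric] mult.commute[of _ g] coprime_dvd_mult_left_iff)
  then have "{i. i < N \<and> N dvd i * d} = (\<lambda>j. M * j) ` {..<g}"
    using M by (auto simp: N elim!: dvdE)
  moreover have "inj_on (\<lambda>j. M * j) {..<g}" using M by (auto simp: inj_on_def)
  ultimately show ?thesis by (simp add: card_image g_def)
qed

text \<open>The multiplicative group is cyclic, so the roots correspond to exponents
  \<open>i\<close> with \<open>N dvd i * d\<close>. It serves both the prime field and its quadratic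
  extension.\<close>

lemma (in field) card_roots_of_unity:
  assumes fin: "finite (carrier R)"
  shows "card {x \<in> carrier R - {\<zero>}. x [^] (d::nat) = \<one>} = gcd d (card (carrier R) - 1)"
proof -
  interpret G: group "mult_of R" rewrites
      "([^]\<^bsub>mult_of R\<^esub>) = (([^]) :: _ \<Rightarrow> nat \<Rightarrow> _)" and "\<one>\<^bsub>mult_of R\<^esub> = \<one>"
    by (rule field_mult_group) (simp_all add: fun_eq_iff nat_pow_def mult_of_simps)
  obtain a where a: "a \<in> carrier (mult_of R)"
    and gen: "carrier (mult_of R) = {a [^] i | i::nat. i \<in> UNIV}"
    using finite_field_mult_group_has_gen[OF fin] by blast
  have fin': "finite (carrier (mult_of R))" using fin by (rule finite_mult_of)
  define N where "N = G.ord a"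
  have N: "N > 0" using G.ord_ge_1[OF fin' a] by (simp add: N_def)
  have el: "carrier (mult_of R) = (\<lambda>i. a [^] i) ` {0..N - 1}"
    using G.ord_elems[OF fin' a] gen unfolding N_def by auto
  have int: "{0..N - 1} = {i. i < N}" using N by auto
  have inj: "inj_on (\<lambda>i. a [^] i) {i. i < N}"
    using G.ord_inj[OF a] unfolding N_def[symmetric] int .
  have "N = card (carrier (mult_of R))"
    unfolding el int by (simp add: card_image[OF inj])
  then have Nq: "N = card (carrier R) - 1" using fin by (simp add: mult_of_simps)
  have pw: "(a [^] i) [^] d = \<one> \<longleftrightarrow> N dvd i * d" for i :: nat
    using G.pow_eq_id[OF a, of "i * d"] G.nat_pow_pow[OF a, of i d] by (simp add: N_def)
  have "{x \<in> carrier R - {\<zero>}. x [^] d = \<one>} = (\<lambda>i. a [^] i) ` {i. i < N \<and> N dvd i * d}"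
    using el pw unfolding int by (auto simp: mult_of_simps)
  also have "card \<dots> = card {i. i < N \<and> N dvd i * d}"
    by (rule card_image) (rule inj_on_subset[OF inj], auto)
  finally show ?thesis using card_mult_dvd[OF N] Nq by simp
qed

lemma card_roots_of_unity_mod:
  assumes "Factorial_Ring.prime p"
  shows "card {a \<in> {1..<int p}. [a ^ d = 1] (mod int p)} = gcd d (p - 1)"
proof -
  interpret residues_prime p "residue_ring (int p)" by unfold_locales (use assms in auto)
  have "{a \<in> {1..<int p}. [a ^ d = 1] (mod int p)} =
    {x \<in> carrier (residue_ring (int p)) - {\<zero>\<^bsub>residue_ring (int p)\<^esub>}. x [^]\<^bsub>residue_ring (int p)\<^esub> d = \<one>\<^bsub>residue_ring (int p)\<^esub>}"
  proof -
    have "x [^]\<^bsub>residue_ring (int p)\<^esub> d = \<one>\<^bsub>residue_ring (int p)\<^esub> \<longleftrightarrow> [x ^ d = 1] (mod int p)"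
      if "0 \<le> x" "x < int p" for x
      using pow_cong[of x d] that m_gt_one unfolding one_cong by (simp add: cong_def)
    then show ?thesis by (auto simp: res_carrier_eq res_zero_eq)
  qed
  then show ?thesis using card_roots_of_unity[of d] by (simp add: res_carrier_eq)
qed

lemma prime_power_eq_1_cong_cancel:
  fixes a :: int
  assumes "Factorial_Ring.prime p" "\<not> int p dvd a" "k > 0"
  shows "[a ^ k = a] (mod int p) \<longleftrightarrow> [a ^ (k - 1) = 1] (mod int p)"
proof -
  have cp: "coprime a (int p)"
    using assms(1,2) prime_imp_coprime[of "int p" a] by (simp add: coprime_commute)
  have "a ^ k = a * a ^ (k - 1)" using assms(3) by (cases k) auto
  then show ?thesis using cong_mult_lcancel[OF cp, of "a ^ (k - 1)" 1] by simp
qed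

text \<open>The expression of \<open>X^(k+1)\<close> through \<open>U\<close>, evaluated at a root
  \<open>a\<close> of \<open>X^2 - s X + t\<close>.\<close>

lemma lucasU_root:
  assumes "[a\<^sup>2 = s * a - t] (mod m)"
  shows "[a ^ Suc k = lucasU s t (Suc k) * a - t * lucasU s t k] (mod m)"
proof (induction k)
  case (Suc k)
  have "[a * a ^ Suc k = a * (lucasU s t (Suc k) * a - t * lucasU s t k)] (mod m)"
    using Suc by (intro cong_mult cong_refl)
  also have "a * (lucasU s t (Suc k) * a - t * lucasU s t k)
     = lucasU s t (Suc k) * a\<^sup>2 - t * lucasU s t k * a" by (simp add: power2_eq_square algebra_simps)
  also have "[\<dots> = lucasU s t (Suc k) * (s * a - t) - t * lucasU s t k * a] (mod m)"
    using assms by (intro cong_mult cong_diff cong_refl)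
  also have "lucasU s t (Suc k) * (s * a - t) - t * lucasU s t k * a =
     lucasU s t (Suc (Suc k)) * a - t * lucasU s t (Suc k)" by (simp add: algebra_simps)
  finally show ?case by simp
qed simp

text \<open>
  A split quadratic satisfying the condition is \<open>(X - a) (X - a^n)\<close> with \<open>a^(n^2) = a \<noteq> a^n\<close>, and exactly
  two values of \<open>a\<close> produce it.
\<close>

lemma card_local_liars_split:
  assumes p: "Factorial_Ring.prime p" "p > 2" and n: "n > 1"
  shows "2 * card (local_liars n p p 1) + gcd (n - 1) (p - 1) = gcd (n\<^sup>2 - 1) (p - 1)"
proof -
  let ?P = "int p"
  \<comment> \<open>\<open>A\<close> collects the units with \<open>a^(n^2) = a\<close> and
    \<open>a^n\<close> different from \<open>a\<close>, written with roots of unity;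
    \<open>f a\<close> holds the coefficients of \<open>(X - a) (X - a^n)\<close>.\<close>
  define A where "A = {a \<in> {1..<?P}. [a ^ (n\<^sup>2 - 1) = 1] (mod ?P) \<and> \<not> [a ^ (n - 1) = 1] (mod ?P)}"
  define f where "f a = ((- (a + a ^ n)) mod ?P, (a * a ^ n) mod ?P)" for a
  have pp: "Factorial_Ring.prime ?P" using p by simp
  have ndvd: "\<not> ?P dvd a" if "a \<in> {1..<?P}" for a using that by (auto dest: zdvd_imp_le)
  have dvdm: "?P dvd x * y \<longleftrightarrow> ?P dvd x \<or> ?P dvd y" for x y
    using pp by (rule prime_dvd_mult_iff)
  have modin: "x mod ?P \<in> {1..<?P}" if "\<not> ?P dvd x" for x
    using that pp prime_gt_0_int[OF pp] pos_mod_bound[of ?P x] pos_mod_sign[of ?P x]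
    by (auto simp: dvd_eq_mod_eq_0 int_one_le_iff_zero_less order_less_le)
  have mc: "[x mod ?P = x] (mod ?P)" for x by simp
  have Aiff: "a \<in> A \<longleftrightarrow> a \<in> {1..<?P} \<and> [(a ^ n) ^ n = a] (mod ?P) \<and> \<not> [a ^ n = a] (mod ?P)" for a
  proof (cases "a \<in> {1..<?P}")
    case True
    have "n\<^sup>2 > 0" "n > 0" using n by auto
    then show ?thesis using True prime_power_eq_1_cong_cancel[OF p(1) ndvd[OF True], of "n\<^sup>2"]
      prime_power_eq_1_cong_cancel[OF p(1) ndvd[OF True], of n]
      by (simp add: A_def power_mult[symmetric] power2_eq_square)
  qed (auto simp: A_def)
  obtain j where nj: "n = Suc j" using n by (cases n) auto
  have root: "[x\<^sup>2 = - b * x - c] (mod ?P)" if "[- b = x + y] (mod ?P)" "[c = x * y] (mod ?P)" for x y b c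
  proof -
    have "[- b * x - c = (x + y) * x - x * y] (mod ?P)"
      using that by (intro cong_diff cong_mult cong_refl)
    then show ?thesis by (simp add: power2_eq_square algebra_simps cong_sym_eq)
  qed
  \<comment> \<open>A linear polynomial over a field is determined by its values at two distinct
    points, so the condition on the coefficients of \<open>X^n\<close> modulo the quadratic may be
    tested at both roots.\<close>
  have cr: "conj_root n ?P b c \<longleftrightarrow> [x ^ n = y] (mod ?P) \<and> [y ^ n = x] (mod ?P)"
    if s: "[- b = x + y] (mod ?P)" and t: "[c = x * y] (mod ?P)" and xy: "\<not> [x = y] (mod ?P)" for x y b c
  proof -
    define u v where "u = lucasU (- b) c n" and "v = c * lucasU (- b) c j"
    have px: "[x ^ n = u * x - v] (mod ?P)"
      using lucasU_root[OF root[OF s t], of j] by (simp add: nj u_def v_def)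
    have py: "[y ^ n = u * y - v] (mod ?P)"
      using lucasU_root[OF root[of b y x c], of j] s t
      by (simp add: nj u_def v_def add.commute mult.commute)
    have crd: "conj_root n ?P b c \<longleftrightarrow> [u = - 1] (mod ?P) \<and> [v = b] (mod ?P)"
      by (simp add: conj_root_def u_def v_def nj cong_iff_dvd_diff)
    show ?thesis
    proof
      assume "conj_root n ?P b c"
      then have uv: "[u = - 1] (mod ?P)" "[v = b] (mod ?P)" unfolding crd by auto
      have "[x ^ n = - 1 * x - b] (mod ?P)" "[y ^ n = - 1 * y - b] (mod ?P)"
        using px py uv by (meson cong_diff cong_mult cong_refl cong_trans)+
      moreover have "[- 1 * x - b = - 1 * x + (x + y)] (mod ?P)" "[- 1 * y - b = - 1 * y + (x + y)] (mod ?P)"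
        using cong_add[OF cong_refl s] by (simp_all only: diff_conv_add_uminus)
      ultimately show "[x ^ n = y] (mod ?P) \<and> [y ^ n = x] (mod ?P)"
        by (auto intro: cong_trans)
    next
      assume *: "[x ^ n = y] (mod ?P) \<and> [y ^ n = x] (mod ?P)"
      have 1: "[u * x - v = y] (mod ?P)" "[u * y - v = x] (mod ?P)"
        using * px py by (meson cong_sym cong_trans)+
      \<comment> \<open>Subtraction of the two values eliminates \<open>v\<close>, leaving
        \<open>(u + 1) (x - y)\<close>.\<close>
      have "?P dvd (u * x - v - y) - (u * y - v - x)"
        using 1 unfolding cong_iff_dvd_diff by (rule dvd_diff)
      then have "?P dvd (u + 1) * (x - y)" by (simp add: algebra_simps)
      then have "?P dvd u + 1" using xy unfolding dvdm cong_iff_dvd_diff by blast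
      then have u: "[u = - 1] (mod ?P)" by (simp add: cong_iff_dvd_diff)
      have "[v = u * x - y] (mod ?P)" using 1(1) by (simp add: cong_iff_dvd_diff algebra_simps dvd_diff_commute)
      also have "[u * x - y = - 1 * x - y] (mod ?P)" by (intro cong_diff cong_mult u cong_refl)
      also have "- 1 * x - y = - (x + y)" by simp
      also have "[- (x + y) = b] (mod ?P)" using s by (metis cong_minus_minus_iff cong_sym minus_minus)
      finally show "conj_root n ?P b c" unfolding crd using u by blast
    qed
  qed
  have disc: "[b\<^sup>2 - 4 * c = (x - y)\<^sup>2] (mod ?P)"
    if s: "[- b = x + y] (mod ?P)" and t: "[c = x * y] (mod ?P)" for x y b c
  proof -
    have "[(- b)\<^sup>2 - 4 * c = (x + y)\<^sup>2 - 4 * (x * y)] (mod ?P)"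
      by (intro cong_diff cong_pow cong_mult s t cong_refl)
    then show ?thesis by (simp add: power2_eq_square algebra_simps)
  qed
  have leg1: "local_symbol D p = 1 \<longleftrightarrow> \<not> ?P dvd D \<and> QuadRes ?P D" for D
    using p by (auto simp: local_symbol_def Legendre_def cong_0_iff)
  have fA: "f ` A \<subseteq> local_liars n p p 1"
  proof
    fix z assume "z \<in> f ` A"
    then obtain a where a: "a \<in> A" and z: "z = f a" by auto
    define b c where "b = (- (a + a ^ n)) mod ?P" and "c = (a * a ^ n) mod ?P"
    have bc: "[b = - (a + a ^ n)] (mod ?P)" "[c = a * a ^ n] (mod ?P)" by (simp_all add: b_def c_def)
    then have s: "[- b = a + a ^ n] (mod ?P)" by (metis cong_minus_minus_iff minus_minus)
    have a': "a \<in> {1..<?P}" "[(a ^ n) ^ n = a] (mod ?P)" "\<not> [a = a ^ n] (mod ?P)"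
      using a unfolding Aiff by (auto simp: cong_sym_eq)
    have "conj_root n ?P b c" using cr[OF s bc(2) a'(3)] a'(2) by simp
    moreover have "\<not> ?P dvd a * a ^ n" using ndvd[OF a'(1)] pp unfolding dvdm
      by (auto dest: prime_dvd_power[OF pp])
    then have "\<not> ?P dvd c" using cong_dvd_iff[OF bc(2)] by blast
    moreover have d: "\<not> ?P dvd b\<^sup>2 - 4 * c"
      using cong_dvd_iff[OF disc[OF s bc(2)]] a'(3) pp by (auto simp: cong_iff_dvd_diff dest: prime_dvd_power[OF pp])
    moreover have "QuadRes ?P (b\<^sup>2 - 4 * c)"
      using disc[OF s bc(2)] unfolding QuadRes_def by (auto intro: cong_sym)
    ultimately show "z \<in> local_liars n p p 1"
      using p by (auto simp: z f_def local_liars_def leg1 dvdm b_def[symmetric] c_def[symmetric])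
         (auto simp: b_def c_def)
  qed
  have fib: "card {x \<in> A. f x = y} = 2" if y: "y \<in> local_liars n p p 1" for y
  proof -
    obtain b c where y: "y = (b, c)" and bc: "b \<in> {0..<?P}" "c \<in> {0..<?P}" "conj_root n ?P b c"
      "\<not> ?P dvd c" "\<not> ?P dvd b\<^sup>2 - 4 * c" "QuadRes ?P (b\<^sup>2 - 4 * c)"
      using y unfolding local_liars_def leg1 dvdm by auto
    obtain w where w: "[w\<^sup>2 = b\<^sup>2 - 4 * c] (mod ?P)" using bc(6) by (auto simp: QuadRes_def)
    have wn: "\<not> ?P dvd w" using bc(5) cong_dvd_iff[OF w] by (auto simp: power2_eq_square)
    have "odd p" using p prime_odd_nat by simp
    then obtain k where "p = 2 * k + 1" by (elim oddE)
    then have h: "?P = 2 * (int k + 1) - 1" by simp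
    \<comment> \<open>\<open>h = (p + 1) / 2\<close> is the inverse of 2 modulo \<open>p\<close>;
      with it \<open>a\<close> and \<open>a'\<close> are the roots from the quadratic
      formula.\<close>
    define h where "h = int k + 1"
    note h = h[folded h_def]
    define a a' where "a = ((w - b) * h) mod ?P" and "a' = ((- w - b) * h) mod ?P"
    have a: "[a = (w - b) * h] (mod ?P)" and a': "[a' = (- w - b) * h] (mod ?P)"
      by (simp_all add: a_def a'_def)
    have "[a + a' = (w - b) * h + (- w - b) * h] (mod ?P)" by (intro cong_add a a')
    also have "(w - b) * h + (- w - b) * h = - b + ?P * (- b)" unfolding h by (simp add: algebra_simps)
    also have "[\<dots> = - b] (mod ?P)" by (simp add: cong_iff_dvd_diff)
    finally have s: "[- b = a + a'] (mod ?P)" by (rule cong_sym)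
    have "[a * a' = ((w - b) * h) * ((- w - b) * h)] (mod ?P)" by (intro cong_mult a a')
    also have "((w - b) * h) * ((- w - b) * h) = h\<^sup>2 * (b\<^sup>2 - w\<^sup>2)"
      by (simp add: power2_eq_square algebra_simps)
    also have "[\<dots> = h\<^sup>2 * (b\<^sup>2 - (b\<^sup>2 - 4 * c))] (mod ?P)"
      by (intro cong_mult cong_diff cong_refl w)
    also have "h\<^sup>2 * (b\<^sup>2 - (b\<^sup>2 - 4 * c)) = c + ?P * (c * (2 * h + 1))"
      unfolding h by (simp add: power2_eq_square algebra_simps)
    also have "[\<dots> = c] (mod ?P)" by (simp add: cong_iff_dvd_diff)
    finally have t: "[c = a * a'] (mod ?P)" by (rule cong_sym)
    have neq: "\<not> [a = a'] (mod ?P)"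
      using cong_dvd_iff[OF disc[OF s t]] bc(5) by (auto simp: cong_iff_dvd_diff power2_eq_square)
    have pows: "[a ^ n = a'] (mod ?P)" "[a' ^ n = a] (mod ?P)" using cr[OF s t neq] bc(3) by auto
    have nd: "\<not> ?P dvd a" "\<not> ?P dvd a'"
      using bc(4) cong_dvd_iff[OF t] by auto
    have "a \<in> {1..<?P}" "a' \<in> {1..<?P}" using nd modin[of a] modin[of a'] by (auto simp: a_def a'_def)
    moreover have "[(a ^ n) ^ n = a] (mod ?P)" "[(a' ^ n) ^ n = a'] (mod ?P)"
      using pows by (meson cong_pow cong_trans)+
    moreover have "\<not> [a ^ n = a] (mod ?P)" "\<not> [a' ^ n = a'] (mod ?P)"
      using pows neq by (meson cong_sym cong_trans)+
    ultimately have inA: "a \<in> A" "a' \<in> A" unfolding Aiff by auto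
    have fval: "f x = (b, c)" if "[x + x ^ n = - b] (mod ?P)" "[x * x ^ n = c] (mod ?P)" for x
    proof -
      have "[- (x + x ^ n) = b] (mod ?P)" using that(1) by (metis cong_minus_minus_iff minus_minus)
      then show ?thesis using that(2) bc(1,2) by (simp add: f_def cong_def)
    qed
    have "f a = (b, c)"
    proof (rule fval)
      show "[a + a ^ n = - b] (mod ?P)" using cong_add[OF cong_refl pows(1)] s by (meson cong_sym cong_trans)
      show "[a * a ^ n = c] (mod ?P)" using cong_mult[OF cong_refl pows(1)] t by (meson cong_sym cong_trans)
    qed
    moreover have "f a' = (b, c)"
    proof (rule fval)
      show "[a' + a' ^ n = - b] (mod ?P)" using cong_add[OF cong_refl pows(2), of a'] s
        by (metis add.commute cong_sym cong_trans)
      show "[a' * a' ^ n = c] (mod ?P)" using cong_mult[OF cong_refl pows(2), of a'] t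
        by (metis mult.commute cong_sym cong_trans)
    qed
    moreover have "x \<in> {a, a'}" if x: "x \<in> A" "f x = (b, c)" for x
    proof -
      have x1: "[x * x ^ n = c] (mod ?P)" "[- (x + x ^ n) = b] (mod ?P)"
        using x(2) bc(1,2) by (auto simp: f_def cong_def)
      then have x2: "[- b = x + x ^ n] (mod ?P)" by (metis cong_minus_minus_iff minus_minus cong_sym)
      have "[x\<^sup>2 = - b * x - c] (mod ?P)" by (rule root[OF x2]) (use x1 in \<open>simp add: cong_sym_eq\<close>)
      also have "[- b * x - c = (a + a') * x - a * a'] (mod ?P)"
        by (intro cong_diff cong_mult s t cong_refl)
      finally have "?P dvd (x - a) * (x - a')"
        by (simp add: cong_iff_dvd_diff power2_eq_square algebra_simps)
      then have "[x = a] (mod ?P) \<or> [x = a'] (mod ?P)" by (simp add: dvdm cong_iff_dvd_diff)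
      then show ?thesis using x(1) inA unfolding Aiff by (auto simp: cong_def)
    qed
    ultimately have "{x \<in> A. f x = y} = {a, a'}" using inA y by auto
    moreover have "a \<noteq> a'" using neq by auto
    ultimately show ?thesis by simp
  qed
  have finA: "finite A" unfolding A_def by (rule finite_subset[of _ "{1..<?P}"]) auto
  have cA: "card A = 2 * card (local_liars n p p 1)"
    by (rule card_two_to_one[OF finA _ fA fib]) auto
  \<comment> \<open>As \<open>n - 1\<close> divides \<open>n^2 - 1\<close>, the units with
    \<open>a^(n-1) = 1\<close> lie among those with \<open>a^(n^2-1) = 1\<close>, and
    \<open>A\<close> is their complement there.\<close>
  have "{a \<in> {1..<?P}. [a ^ (n\<^sup>2 - 1) = 1] (mod ?P)} = A \<union> {a \<in> {1..<?P}. [a ^ (n - 1) = 1] (mod ?P)}"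
  proof -
    have nn: "n\<^sup>2 - 1 = (n - 1) * (n + 1)" by (simp add: nj power2_eq_square)
    have "[a ^ (n\<^sup>2 - 1) = 1] (mod ?P)" if "[a ^ (n - 1) = 1] (mod ?P)" for a
      using cong_pow[OF that, of "n + 1"] unfolding nn power_mult power_one .
    then show ?thesis unfolding A_def by blast
  qed
  then have "card {a \<in> {1..<?P}. [a ^ (n\<^sup>2 - 1) = 1] (mod ?P)} =
      card (A \<union> {a \<in> {1..<?P}. [a ^ (n - 1) = 1] (mod ?P)})" by (rule arg_cong)
  then have "gcd (n\<^sup>2 - 1) (p - 1) = card (A \<union> {a \<in> {1..<?P}. [a ^ (n - 1) = 1] (mod ?P)})"
    unfolding card_roots_of_unity_mod[OF p(1)] .
  also have "\<dots> = card A + gcd (n - 1) (p - 1)"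
    unfolding card_roots_of_unity_mod[OF p(1), of "n - 1", symmetric] using finA
    by (intro card_Un_disjoint) (auto simp: A_def intro: finite_subset[of _ "{1..<?P}"])
  finally show ?thesis by (simp add: cA)
qed

section \<open>Inert quadratics modulo a prime\<close>

text \<open>Euler's criterion is multiplicative. It ensures that every inert quadratic has its roots
  in the extension by the square root of one fixed nonresidue.\<close>

lemma Legendre_mult_nonresidues:
  assumes p: "Factorial_Ring.prime p" "p > 2"
    and "Legendre a (int p) = - 1" "Legendre b (int p) = - 1"
  shows "Legendre (a * b) (int p) = 1"
proof -
  define e where "e = (p - 1) div 2"
  have "[Legendre (a * b) (int p) = a ^ e * b ^ e] (mod int p)"
    using euler_criterion[OF p, of "a * b"] by (simp add: e_def power_mult_distrib)
  also have "[a ^ e * b ^ e = (- 1) * (- 1)] (mod int p)"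
    using euler_criterion[OF p, of a] euler_criterion[OF p, of b] assms(3,4)
    by (intro cong_mult) (auto simp: e_def cong_sym_eq)
  finally have "int p dvd Legendre (a * b) (int p) - 1" by (simp add: cong_iff_dvd_diff)
  \<comment> \<open>The symbol is \<open>-1\<close>, \<open>0\<close> or \<open>1\<close>; excluding
    the differences \<open>-2\<close> and \<open>-1\<close> turns the congruence into an
    equality.\<close>
  moreover have "\<not> int p dvd - 1" "\<not> int p dvd - 2" using p by (auto dest: zdvd_imp_le)
  ultimately show ?thesis by (auto simp: Legendre_def split: if_splits)
qed

text \<open>Otherwise all \<open>p - 1\<close> units would satisfy \<open>a^((p-1)/2) = 1\<close>,
  an equation with at most \<open>(p-1)/2\<close> solutions.\<close>

lemma ex_nonresidue:
  assumes p: "Factorial_Ring.prime p" "p > 2"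
  shows "\<exists>\<nu>. Legendre \<nu> (int p) = - 1"
proof (rule ccontr)
  assume neg: "\<nexists>\<nu>. Legendre \<nu> (int p) = - 1"
  have "odd p" using p prime_odd_nat by simp
  define e where "e = (p - 1) div 2"
  have e: "e > 0" "e < p - 1" using p by (auto simp: e_def)
  have "{a \<in> {1..<int p}. [a ^ e = 1] (mod int p)} = {1..<int p}"
  proof -
    have "[a ^ e = 1] (mod int p)" if "a \<in> {1..<int p}" for a
    proof -
      have "\<not> int p dvd a" using that by (auto dest: zdvd_imp_le)
      then have "Legendre a (int p) = 1" using neg by (auto simp: Legendre_def cong_0_iff split: if_splits)
      then show ?thesis using euler_criterion[OF p, of a] by (simp add: e_def cong_sym_eq)
    qed
    then show ?thesis by blast
  qed
  then have "card {1..<int p} = gcd e (p - 1)" using card_roots_of_unity_mod[OF p(1), of e] by simp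
  moreover have "gcd e (p - 1) \<le> e" using e by (simp add: gcd_le1_nat)
  moreover have "card {1..<int p} = p - 1" using p by (simp add: nat_diff_distrib)
  ultimately show False using e by linarith
qed

text \<open>The pair \<open>(x, y)\<close> stands for \<open>x + y \<surd>\<nu>\<close> over the integers modulo \<open>P\<close>.\<close>

definition quad_ext :: "int \<Rightarrow> int \<Rightarrow> (int \<times> int) ring" where
  "quad_ext P \<nu> = \<lparr>carrier = {0..<P} \<times> {0..<P},
     monoid.mult = \<lambda>\<alpha> \<beta>. ((fst \<alpha> * fst \<beta> + \<nu> * snd \<alpha> * snd \<beta>) mod P, (fst \<alpha> * snd \<beta> + snd \<alpha> * fst \<beta>) mod P),
     one = (1, 0), zero = (0, 0),
     add = \<lambda>\<alpha> \<beta>. ((fst \<alpha> + fst \<beta>) mod P, (snd \<alpha> + snd \<beta>) mod P)\<rparr>"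

lemma mod_bilinear:
  fixes P \<nu> a b c d :: int
  shows "(a mod P * b + \<nu> * (c mod P) * d) mod P = (a * b + \<nu> * c * d) mod P"
    "(a * (b mod P) + \<nu> * c * (d mod P)) mod P = (a * b + \<nu> * c * d) mod P"
    "(a mod P * b + c mod P * d) mod P = (a * b + c * d) mod P"
    "(a * (b mod P) + c * (d mod P)) mod P = (a * b + c * d) mod P"
  unfolding cong_def[symmetric] by (intro cong_add cong_mult cong_refl; simp)+

lemma quad_ext_cring:
  assumes "P > 1"
  shows "cring (quad_ext P \<nu>)"
proof (rule cringI)
  show "abelian_group (quad_ext P \<nu>)"
  proof (rule abelian_groupI)
    fix x assume "x \<in> carrier (quad_ext P \<nu>)"
    then show "\<exists>y\<in>carrier (quad_ext P \<nu>). y \<oplus>\<^bsub>quad_ext P \<nu>\<^esub> x = \<zero>\<^bsub>quad_ext P \<nu>\<^esub>"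
      using assms by (intro bexI[of _ "((- fst x) mod P, (- snd x) mod P)"])
        (auto simp: quad_ext_def mod_simps)
  qed (use assms in \<open>auto simp: quad_ext_def mod_simps ac_simps\<close>)
  show "comm_monoid (quad_ext P \<nu>)"
  proof (rule comm_monoidI)
    fix x y z
    show "x \<otimes>\<^bsub>quad_ext P \<nu>\<^esub> y \<otimes>\<^bsub>quad_ext P \<nu>\<^esub> z = x \<otimes>\<^bsub>quad_ext P \<nu>\<^esub> (y \<otimes>\<^bsub>quad_ext P \<nu>\<^esub> z)"
      unfolding quad_ext_def by (simp only: mod_bilinear partial_object.simps monoid.simps fst_conv snd_conv)
        (simp add: algebra_simps)
  qed (use assms in \<open>auto simp: quad_ext_def ac_simps\<close>)
  fix x y z
  show "(x \<oplus>\<^bsub>quad_ext P \<nu>\<^esub> y) \<otimes>\<^bsub>quad_ext P \<nu>\<^esub> z =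
      x \<otimes>\<^bsub>quad_ext P \<nu>\<^esub> z \<oplus>\<^bsub>quad_ext P \<nu>\<^esub> y \<otimes>\<^bsub>quad_ext P \<nu>\<^esub> z"
    unfolding quad_ext_def
    by (simp only: mod_bilinear partial_object.simps monoid.simps ring.simps fst_conv snd_conv mod_add_eq)
      (simp add: algebra_simps)
qed

lemma prime_cong_inverse:
  fixes a :: int
  assumes "Factorial_Ring.prime p" "\<not> int p dvd a"
  shows "\<exists>w. [a * w = 1] (mod int p)"
proof -
  have "coprime a (int p)" using assms prime_imp_coprime[of "int p" a] by (simp add: coprime_commute)
  then show ?thesis by (simp add: coprime_iff_invertible_int)
qed

text \<open>If \<open>y\<close> were invertible, \<open>\<nu>\<close> would be the square of
  \<open>x / y\<close>. Thus the norm form is anisotropic, which makes \<open>quad_ext\<close> a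
  field.\<close>

lemma nonresidue_norm:
  assumes p: "Factorial_Ring.prime p" and nu: "Legendre \<nu> (int p) = - 1"
    and "int p dvd x\<^sup>2 - \<nu> * y\<^sup>2"
  shows "int p dvd x \<and> int p dvd y"
proof -
  have pp: "Factorial_Ring.prime (int p)" using p by simp
  have c: "[x\<^sup>2 = \<nu> * y\<^sup>2] (mod int p)" using assms(3) by (simp add: cong_iff_dvd_diff)
  have "int p dvd y"
  proof (rule ccontr)
    assume "\<not> int p dvd y"
    then obtain w where w: "[y * w = 1] (mod int p)" using prime_cong_inverse[OF p] by blast
    have "[(x * w)\<^sup>2 = \<nu> * y\<^sup>2 * w\<^sup>2] (mod int p)"
      unfolding power_mult_distrib by (intro cong_mult c cong_refl)
    also have "\<nu> * y\<^sup>2 * w\<^sup>2 = \<nu> * (y * w)\<^sup>2" by (simp add: power_mult_distrib)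
    also have "[\<nu> * (y * w)\<^sup>2 = \<nu> * 1\<^sup>2] (mod int p)" by (intro cong_mult cong_pow w cong_refl)
    finally have "QuadRes (int p) \<nu>" by (auto simp: QuadRes_def)
    then show False using nu by (simp add: Legendre_def split: if_splits)
  qed
  moreover from this have "int p dvd x\<^sup>2"
    using cong_dvd_iff[OF c] by (simp add: power2_eq_square)
  then have "int p dvd x" using prime_dvd_power[OF pp] by blast
  ultimately show ?thesis by simp
qed

lemma quad_ext_field:
  assumes p: "Factorial_Ring.prime p" and nu: "Legendre \<nu> (int p) = - 1"
  shows "field (quad_ext (int p) \<nu>)"
proof -
  let ?K = "quad_ext (int p) \<nu>"
  have p1: "int p > 1" using p prime_gt_1_nat by auto
  interpret cring ?K by (rule quad_ext_cring[OF p1])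
  show ?thesis
  proof (rule cring.field_intro2[OF is_cring])
    show "\<zero>\<^bsub>?K\<^esub> \<noteq> \<one>\<^bsub>?K\<^esub>" by (simp add: quad_ext_def)
    show "\<alpha> \<in> Units ?K" if "\<alpha> \<in> carrier ?K - {\<zero>\<^bsub>?K\<^esub>}" for \<alpha>
    proof -
      have \<alpha>: "\<alpha> \<in> carrier ?K - {\<zero>\<^bsub>?K\<^esub>}" by (rule that)
      obtain x y where xy: "\<alpha> = (x, y)" by (cases \<alpha>)
      have "\<not> (int p dvd x \<and> int p dvd y)"
        using \<alpha> by (auto simp: xy quad_ext_def dest!: zdvd_imp_le)
      then have "\<not> int p dvd x\<^sup>2 - \<nu> * y\<^sup>2" using nonresidue_norm[OF p nu] by blast
      then obtain w where w: "[(x\<^sup>2 - \<nu> * y\<^sup>2) * w = 1] (mod int p)" using prime_cong_inverse[OF p] by blast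
      \<comment> \<open>The inverse is the conjugate divided by the norm; \<open>w\<close> is the
        inverse of the norm.\<close>
      define \<beta> where "\<beta> = ((x * w) mod int p, (- y * w) mod int p)"
      have "\<alpha> \<otimes>\<^bsub>?K\<^esub> \<beta> = (((x\<^sup>2 - \<nu> * y\<^sup>2) * w) mod int p, 0)"
      proof -
        have "[x * (x * w mod int p) + \<nu> * y * (- y * w mod int p) = x * (x * w) + \<nu> * y * (- y * w)] (mod int p)"
          "[x * (- y * w mod int p) + y * (x * w mod int p) = x * (- y * w) + y * (x * w)] (mod int p)"
          by (intro cong_add cong_mult cong_refl; simp)+
        moreover have "x * (x * w) + \<nu> * y * (- y * w) = (x\<^sup>2 - \<nu> * y\<^sup>2) * w"
          "x * (- y * w) + y * (x * w) = 0"
          by (simp_all add: algebra_simps power2_eq_square)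
        ultimately show ?thesis by (simp add: \<beta>_def xy quad_ext_def cong_def)
      qed
      also have "\<dots> = \<one>\<^bsub>?K\<^esub>" using w p1 by (simp add: quad_ext_def cong_def)
      finally have 1: "\<alpha> \<otimes>\<^bsub>?K\<^esub> \<beta> = \<one>\<^bsub>?K\<^esub>" .
      have \<beta>: "\<beta> \<in> carrier ?K" using p1 by (simp add: \<beta>_def quad_ext_def)
      show "\<alpha> \<in> Units ?K" using \<alpha> \<beta> 1 m_comm[of \<alpha> \<beta>] by (auto simp: Units_def)
    qed
  qed
qed

text \<open>The element \<open>\<alpha> = x + y \<surd>\<nu>\<close> is a root of the polynomial
  with trace \<open>s = 2 x\<close> and norm \<open>t\<close>, so
  \<open>\<alpha>^(k+1) = U_(k+1) \<alpha> - t U_k\<close>.\<close>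

lemma quad_ext_pow:
  fixes P \<nu> x y :: int
  assumes "0 \<le> x" "x < P" "0 \<le> y" "y < P" "P > 1"
  defines "s \<equiv> 2 * x" and "t \<equiv> x\<^sup>2 - \<nu> * y\<^sup>2"
  shows "(x, y) [^]\<^bsub>quad_ext P \<nu>\<^esub> Suc k =
    ((lucasU s t (Suc k) * x - t * lucasU s t k) mod P, (lucasU s t (Suc k) * y) mod P)"
proof (induction k)
  case 0
  interpret cring "quad_ext P \<nu>" by (rule quad_ext_cring[OF assms(5)])
  have "(x, y) \<in> carrier (quad_ext P \<nu>)" using assms by (simp add: quad_ext_def)
  then show ?case using assms by (simp del: nat_pow_Suc add: nat_pow_eone[simplified])
next
  case (Suc k)
  have "(x, y) [^]\<^bsub>quad_ext P \<nu>\<^esub> Suc (Suc k) = (x, y) [^]\<^bsub>quad_ext P \<nu>\<^esub> Suc k \<otimes>\<^bsub>quad_ext P \<nu>\<^esub> (x, y)"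
    by (simp add: nat_pow_def)
  also have "\<dots> = (((lucasU s t (Suc k) * x - t * lucasU s t k) * x + \<nu> * (lucasU s t (Suc k) * y) * y) mod P,
     ((lucasU s t (Suc k) * x - t * lucasU s t k) * y + (lucasU s t (Suc k) * y) * x) mod P)"
    unfolding Suc.IH unfolding quad_ext_def
    by (simp only: mod_bilinear partial_object.simps monoid.simps fst_conv snd_conv)
  also have "(lucasU s t (Suc k) * x - t * lucasU s t k) * x + \<nu> * (lucasU s t (Suc k) * y) * y
      = lucasU s t (Suc (Suc k)) * x - t * lucasU s t (Suc k)"
    by (simp add: s_def t_def algebra_simps power2_eq_square)
  also have "(lucasU s t (Suc k) * x - t * lucasU s t k) * y + (lucasU s t (Suc k) * y) * x
      = lucasU s t (Suc (Suc k)) * y"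
    by (simp add: s_def algebra_simps)
  finally show ?case .
qed

lemma quad_ext_pow_real:
  fixes P \<nu> x :: int
  assumes "0 \<le> x" "x < P" "P > 1"
  shows "(x, 0) [^]\<^bsub>quad_ext P \<nu>\<^esub> (k::nat) = (x ^ k mod P, 0)"
proof (induction k)
  case 0
  then show ?case using assms by (simp add: nat_pow_def quad_ext_def)
next
  case (Suc k)
  have "(x, 0) [^]\<^bsub>quad_ext P \<nu>\<^esub> Suc k = (x, 0) [^]\<^bsub>quad_ext P \<nu>\<^esub> k \<otimes>\<^bsub>quad_ext P \<nu>\<^esub> (x, 0)"
    by (simp add: nat_pow_def)
  also have "\<dots> = (x ^ Suc k mod P, 0)"
    unfolding Suc.IH by (simp add: quad_ext_def mod_simps mult.commute)
  finally show ?case .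
qed

text \<open>In coordinates the equation reads \<open>u x - v = x\<close> and
  \<open>u y = - y\<close>. As \<open>y\<close> is invertible, the second forces
  \<open>u = - 1\<close>, and then the first says \<open>v = - 2 x\<close>.\<close>

lemma quad_ext_pow_conj:
  fixes x y b c :: int
  assumes p: "Factorial_Ring.prime p" and xy: "0 \<le> x" "x < int p" "0 < y" "y < int p" and n: "n > 0"
    and b: "[b = - (2 * x)] (mod int p)" and c: "[c = x\<^sup>2 - \<nu> * y\<^sup>2] (mod int p)"
  shows "(x, y) [^]\<^bsub>quad_ext (int p) \<nu>\<^esub> n = (x, (- y) mod int p) \<longleftrightarrow> conj_root n (int p) b c"
proof -
  let ?P = "int p"
  have pp: "Factorial_Ring.prime ?P" using p by simp
  have p1: "?P > 1" using p prime_gt_1_nat by auto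
  obtain k where k: "n = Suc k" using n by (cases n) auto
  define t where "t = x\<^sup>2 - \<nu> * y\<^sup>2"
  define u v where "u = lucasU (2 * x) t n" and "v = t * lucasU (2 * x) t k"
  have "(x, y) [^]\<^bsub>quad_ext ?P \<nu>\<^esub> n = ((u * x - v) mod ?P, (u * y) mod ?P)"
    using quad_ext_pow[of x ?P y \<nu> k] xy p1 by (simp add: k u_def v_def t_def del: lucasU.simps)
  then have 1: "(x, y) [^]\<^bsub>quad_ext ?P \<nu>\<^esub> n = (x, (- y) mod ?P) \<longleftrightarrow>
      [u * x - v = x] (mod ?P) \<and> [u * y = - y] (mod ?P)"
    using xy by (simp add: cong_def)
  have "\<not> ?P dvd y" using xy by (auto dest: zdvd_imp_le)
  moreover have "u * y - - y = (u + 1) * y" by (simp add: algebra_simps)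
  ultimately have 2: "[u * y = - y] (mod ?P) \<longleftrightarrow> ?P dvd u + 1"
    unfolding cong_iff_dvd_diff by (simp only: prime_dvd_mult_iff[OF pp]) simp
  have 3: "[u * x - v = x] (mod ?P) \<longleftrightarrow> ?P dvd v + 2 * x" if "?P dvd u + 1"
  proof -
    have "[u * x - v - x = - (v + 2 * x)] (mod ?P)"
      using dvd_mult2[OF that, of x] by (simp add: cong_iff_dvd_diff algebra_simps)
    then show ?thesis unfolding cong_iff_dvd_diff[of "u * x - v"] using cong_dvd_iff dvd_minus_iff by blast
  qed
  have "conj_root n ?P b c \<longleftrightarrow> conj_root n ?P (- (2 * x)) t"
    using b c unfolding t_def by (rule conj_root_cong)
  also have "\<dots> \<longleftrightarrow> ?P dvd u + 1 \<and> ?P dvd v + 2 * x"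
    by (simp add: conj_root_def u_def v_def k)
  finally show ?thesis using 1 2 3 by blast
qed

text \<open>
  For \<open>\<alpha> = x + y \<surd>\<nu>\<close> with \<open>y \<noteq> 0\<close>, the conjugate of \<open>\<alpha>\<close> is \<open>\<alpha>\<^sup>p\<close>, so the condition on its minimal
  polynomial becomes \<open>\<alpha>^(n - p) = 1\<close>.
\<close>

lemma card_local_liars_inert:
  assumes p: "Factorial_Ring.prime p" "p > 2" and n: "p dvd n" "n > 0"
  shows "2 * card (local_liars n p p (- 1)) + gcd (n - p) (p - 1) = gcd (n - p) (p\<^sup>2 - 1)"
proof -
  let ?P = "int p"
  obtain \<nu> where nu: "Legendre \<nu> ?P = - 1" using ex_nonresidue[OF p] by blast
  let ?K = "quad_ext ?P \<nu>"
  interpret K: field ?K by (rule quad_ext_field[OF p(1) nu])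
  have pp: "Factorial_Ring.prime ?P" using p by simp
  have p1: "?P > 1" using p by simp
  have np: "p \<le> n" using n dvd_imp_le by blast
  have dvdm: "?P dvd x * y \<longleftrightarrow> ?P dvd x \<or> ?P dvd y" for x y
    using pp by (rule prime_dvd_mult_iff)
  have nd2: "\<not> ?P dvd 2" "\<not> ?P dvd 4"
  proof -
    show "\<not> ?P dvd 2" using p by (auto dest: zdvd_imp_le)
    then show "\<not> ?P dvd 4" using dvdm[of 2 2] by simp
  qed
  have carr: "carrier ?K = {0..<?P} \<times> {0..<?P}" by (simp add: quad_ext_def)
  \<comment> \<open>The \<open>(n - p)\<close>-th roots of unity outside the prime field;
    \<open>f\<close> assigns to such an element its minimal polynomial.\<close>
  define A where "A = {(x, y). x \<in> {0..<?P} \<and> y \<in> {1..<?P} \<and> (x, y) [^]\<^bsub>?K\<^esub> (n - p) = \<one>\<^bsub>?K\<^esub>}"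
  define f where "f = (\<lambda>(x, y). ((- (2 * x)) mod ?P, (x\<^sup>2 - \<nu> * y\<^sup>2) mod ?P))"
  have nund: "\<not> ?P dvd \<nu>" using nu by (auto simp: Legendre_def cong_0_iff)
  have disc: "[b\<^sup>2 - 4 * c = 4 * \<nu> * y\<^sup>2] (mod ?P)"
    if b: "[b = - (2 * x)] (mod ?P)" and c: "[c = x\<^sup>2 - \<nu> * y\<^sup>2] (mod ?P)" for x y b c
  proof -
    have "[b\<^sup>2 - 4 * c = (- (2 * x))\<^sup>2 - 4 * (x\<^sup>2 - \<nu> * y\<^sup>2)] (mod ?P)"
      by (intro cong_diff cong_pow cong_mult b c cong_refl)
    then show ?thesis by (simp add: power2_eq_square algebra_simps)
  qed
  have leg: "Legendre D ?P = - 1" if D: "[D = 4 * \<nu> * y\<^sup>2] (mod ?P)" and y: "\<not> ?P dvd y" for D y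
  proof -
    have "\<not> ?P dvd D" using cong_dvd_iff[OF D] y nund nd2 by (simp add: dvdm power2_eq_square)
    moreover have "\<not> QuadRes ?P D"
    proof
      assume "QuadRes ?P D"
      then obtain z where "[z\<^sup>2 = D] (mod ?P)" by (auto simp: QuadRes_def)
      then have "?P dvd z\<^sup>2 - \<nu> * (2 * y)\<^sup>2"
        using D cong_trans by (fastforce simp: cong_iff_dvd_diff power2_eq_square algebra_simps)
      then have "?P dvd 2 * y" using nonresidue_norm[OF p(1) nu] by blast
      then show False using y nd2 by (simp add: dvdm)
    qed
    ultimately show ?thesis by (simp add: Legendre_def cong_0_iff)
  qed
  have Aiff: "(x, y) \<in> A \<longleftrightarrow> conj_root n ?P b c"
    if xy: "x \<in> {0..<?P}" "y \<in> {1..<?P}"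
      and b: "[b = - (2 * x)] (mod ?P)" and c: "[c = x\<^sup>2 - \<nu> * y\<^sup>2] (mod ?P)" for x y b c
  proof -
    have ynd: "\<not> ?P dvd y" using xy by (auto dest: zdvd_imp_le)
    \<comment> \<open>Used with the exponent \<open>p\<close> in place of \<open>n\<close>: this
      identifies the Frobenius power of \<open>(x, y)\<close> with its conjugate.\<close>
    have "conj_root p ?P b c"
      using conj_root_nonresidue[OF p leg[OF disc[OF b c] ynd]] .
    then have fr: "(x, y) [^]\<^bsub>?K\<^esub> p = (x, (- y) mod ?P)"
      using quad_ext_pow_conj[OF p(1), of x y p b c \<nu>] xy b c p by simp
    have cl: "(x, y) \<in> carrier ?K" using xy by (simp add: carr)
    have nz: "(x, y) [^]\<^bsub>?K\<^esub> p \<noteq> \<zero>\<^bsub>?K\<^esub>"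
      using ynd unfolding fr by (auto simp: quad_ext_def dvd_eq_mod_eq_0[symmetric])
    have "(x, y) [^]\<^bsub>?K\<^esub> n = (x, y) [^]\<^bsub>?K\<^esub> (n - p) \<otimes>\<^bsub>?K\<^esub> (x, y) [^]\<^bsub>?K\<^esub> p"
      using K.nat_pow_mult[OF cl, of "n - p" p] np by simp
    then have "(x, y) [^]\<^bsub>?K\<^esub> n = (x, y) [^]\<^bsub>?K\<^esub> p \<longleftrightarrow> (x, y) [^]\<^bsub>?K\<^esub> (n - p) = \<one>\<^bsub>?K\<^esub>"
      using K.m_rcancel[of "(x, y) [^]\<^bsub>?K\<^esub> p" "(x, y) [^]\<^bsub>?K\<^esub> (n - p)" "\<one>\<^bsub>?K\<^esub>"] cl nz by simp
    then show ?thesis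
      using quad_ext_pow_conj[OF p(1), of x y n b c \<nu>] xy b c n unfolding fr by (simp add: A_def)
  qed
  have lsym: "local_symbol D p = Legendre D ?P" for D using p by (simp add: local_symbol_def)
  have fA: "f ` A \<subseteq> local_liars n p p (- 1)"
  proof
    fix z assume "z \<in> f ` A"
    then obtain x y where xyA: "(x, y) \<in> A" and z: "z = f (x, y)" by auto
    then have xy: "x \<in> {0..<?P}" "y \<in> {1..<?P}" by (auto simp: A_def)
    define b c where "b = (- (2 * x)) mod ?P" and "c = (x\<^sup>2 - \<nu> * y\<^sup>2) mod ?P"
    have bc: "[b = - (2 * x)] (mod ?P)" "[c = x\<^sup>2 - \<nu> * y\<^sup>2] (mod ?P)"
      by (simp_all add: b_def c_def)
    have ynd: "\<not> ?P dvd y" using xy by (auto dest: zdvd_imp_le)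
    have L: "Legendre (b\<^sup>2 - 4 * c) ?P = - 1" by (rule leg[OF disc[OF bc] ynd])
    have "\<not> ?P dvd c" using cong_dvd_iff[OF bc(2)] nonresidue_norm[OF p(1) nu] ynd by blast
    moreover have "\<not> ?P dvd b\<^sup>2 - 4 * c" using L by (auto simp: Legendre_def cong_0_iff)
    moreover have "conj_root n ?P b c" using Aiff[OF xy bc] xyA by blast
    moreover have "b \<in> {0..<?P}" "c \<in> {0..<?P}" using p1 by (auto simp: b_def c_def)
    moreover have "z = (b, c)" by (simp add: z f_def b_def c_def)
    ultimately show "z \<in> local_liars n p p (- 1)"
      using L by (simp add: local_liars_def lsym dvdm)
  qed
  have fib: "card {z \<in> A. f z = l} = 2" if l: "l \<in> local_liars n p p (- 1)" for l
  proof -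
    obtain b c where l: "l = (b, c)" and bc: "b \<in> {0..<?P}" "c \<in> {0..<?P}" "conj_root n ?P b c"
      "Legendre (b\<^sup>2 - 4 * c) ?P = - 1"
      using l unfolding local_liars_def lsym by auto
    \<comment> \<open>A root needs \<open>x = - b / 2\<close> and
      \<open>4 \<nu> y^2 = b^2 - 4 c\<close>. The latter is solved by
      \<open>y = z / (2 \<nu>)\<close>, where \<open>z\<close> is a square root of the discriminant
      times \<open>\<nu>\<close>.\<close>
    have "Legendre ((b\<^sup>2 - 4 * c) * \<nu>) ?P = 1" by (rule Legendre_mult_nonresidues[OF p bc(4) nu])
    then have "QuadRes ?P ((b\<^sup>2 - 4 * c) * \<nu>)" by (simp add: Legendre_def split: if_splits)
    then obtain z where z: "[z\<^sup>2 = (b\<^sup>2 - 4 * c) * \<nu>] (mod ?P)" by (auto simp: QuadRes_def)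
    have "\<not> ?P dvd 2 * \<nu>" using nund nd2 by (simp add: dvdm)
    then obtain w where w: "[2 * \<nu> * w = 1] (mod ?P)" using prime_cong_inverse[OF p(1)] by blast
    obtain h where h: "[2 * h = 1] (mod ?P)" using prime_cong_inverse[OF p(1) nd2(1)] by blast
    define x y where "x = (- b * h) mod ?P" and "y = (z * w) mod ?P"
    have x: "[x = - b * h] (mod ?P)" and y: "[y = z * w] (mod ?P)" by (simp_all add: x_def y_def)
    have "[2 * x = 2 * (- b * h)] (mod ?P)" by (intro cong_mult x cong_refl)
    also have "2 * (- b * h) = - b * (2 * h)" by simp
    also have "[- b * (2 * h) = - b * 1] (mod ?P)" by (intro cong_mult h cong_refl)
    finally have b: "[b = - (2 * x)] (mod ?P)"
      by (metis cong_minus_minus_iff cong_sym minus_minus mult.right_neutral)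
    have "[4 * \<nu> * y\<^sup>2 = 4 * \<nu> * (z * w)\<^sup>2] (mod ?P)" by (intro cong_mult cong_pow y cong_refl)
    also have "4 * \<nu> * (z * w)\<^sup>2 = 4 * \<nu> * z\<^sup>2 * w\<^sup>2" by (simp add: power_mult_distrib)
    also have "[\<dots> = 4 * \<nu> * ((b\<^sup>2 - 4 * c) * \<nu>) * w\<^sup>2] (mod ?P)" by (intro cong_mult z cong_refl)
    also have "4 * \<nu> * ((b\<^sup>2 - 4 * c) * \<nu>) * w\<^sup>2 = (b\<^sup>2 - 4 * c) * (2 * \<nu> * w)\<^sup>2"
      by (simp add: power2_eq_square algebra_simps)
    also have "[\<dots> = (b\<^sup>2 - 4 * c) * 1\<^sup>2] (mod ?P)" by (intro cong_mult cong_pow w cong_refl)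
    finally have D: "[4 * \<nu> * y\<^sup>2 = b\<^sup>2 - 4 * c] (mod ?P)" by simp
    have "[4 * (x\<^sup>2 - \<nu> * y\<^sup>2) = (- (2 * x))\<^sup>2 - 4 * \<nu> * y\<^sup>2] (mod ?P)"
      by (simp add: power2_eq_square algebra_simps)
    also have "[(- (2 * x))\<^sup>2 - 4 * \<nu> * y\<^sup>2 = b\<^sup>2 - (b\<^sup>2 - 4 * c)] (mod ?P)"
      by (intro cong_diff cong_pow D cong_sym[OF b])
    finally have "?P dvd 4 * ((x\<^sup>2 - \<nu> * y\<^sup>2) - c)"
      by (simp add: cong_iff_dvd_diff algebra_simps)
    then have c: "[c = x\<^sup>2 - \<nu> * y\<^sup>2] (mod ?P)"
      using nd2 by (metis dvdm cong_iff_dvd_diff cong_sym)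
    have "\<not> ?P dvd b\<^sup>2 - 4 * c" using bc(4) by (auto simp: Legendre_def cong_0_iff)
    then have ynd: "\<not> ?P dvd y" using cong_dvd_iff[OF D] by (auto simp: power2_eq_square)
    have xr: "x \<in> {0..<?P}" and yr: "y \<in> {1..<?P}"
    proof -
      show "x \<in> {0..<?P}" using p1 by (simp add: x_def)
      have "0 \<le> y" "y < ?P" using p1 by (simp_all add: y_def)
      moreover have "y \<noteq> 0" using ynd by auto
      ultimately show "y \<in> {1..<?P}" by simp
    qed
    \<comment> \<open>The representative of \<open>- y\<close> in the admissible range: the second
      preimage is the conjugate root.\<close>
    define y' where "y' = ?P - y"
    have yr': "y' \<in> {1..<?P}" using yr by (auto simp: y'_def)
    have y': "[y' = - y] (mod ?P)" by (simp add: y'_def cong_iff_dvd_diff)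
    have "[x\<^sup>2 - \<nu> * y\<^sup>2 = x\<^sup>2 - \<nu> * (- y)\<^sup>2] (mod ?P)" by simp
    also have "[x\<^sup>2 - \<nu> * (- y)\<^sup>2 = x\<^sup>2 - \<nu> * y'\<^sup>2] (mod ?P)"
      by (intro cong_diff cong_mult cong_pow cong_sym[OF y'] cong_refl)
    finally have c': "[c = x\<^sup>2 - \<nu> * y'\<^sup>2] (mod ?P)" using c cong_trans by blast
    have fval: "f (u, v) = (b, c) \<longleftrightarrow> [b = - (2 * u)] (mod ?P) \<and> [c = u\<^sup>2 - \<nu> * v\<^sup>2] (mod ?P)" for u v
    proof -
      have bm: "b mod ?P = b" "c mod ?P = c" using bc(1,2) by auto
      show ?thesis unfolding f_def cong_def prod.case prod.inject bm by blast
    qed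
    have in1: "(x, y) \<in> A" "(x, y') \<in> A"
      using Aiff[OF xr yr b c] Aiff[OF xr yr' b c'] bc(3) by auto
    have in2: "f (x, y) = (b, c)" "f (x, y') = (b, c)" unfolding fval using b c c' by auto
    have in3: "(u, v) = (x, y) \<or> (u, v) = (x, y')" if uv: "(u, v) \<in> A" "f (u, v) = (b, c)" for u v
    proof -
      have ur: "u \<in> {0..<?P}" "v \<in> {1..<?P}" using uv by (auto simp: A_def)
      have "[- (2 * u) = - (2 * x)] (mod ?P)" "[u\<^sup>2 - \<nu> * v\<^sup>2 = x\<^sup>2 - \<nu> * y\<^sup>2] (mod ?P)"
        using uv(2) b c unfolding fval by (meson cong_sym cong_trans)+
      then have "?P dvd 2 * (u - x)" and c2: "[u\<^sup>2 - \<nu> * v\<^sup>2 = x\<^sup>2 - \<nu> * y\<^sup>2] (mod ?P)"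
        unfolding cong_minus_minus_iff by (simp_all add: cong_iff_dvd_diff[of "2 * u"] right_diff_distrib)
      then have "[u = x] (mod ?P)" using nd2 unfolding dvdm cong_iff_dvd_diff by blast
      then have ux: "u = x" using ur xr by (simp add: cong_def)
      have "?P dvd - (\<nu> * ((v - y) * (v + y)))"
        using c2 by (simp add: cong_iff_dvd_diff ux power2_eq_square algebra_simps)
      then have "?P dvd v - y \<or> ?P dvd v + y" using nund unfolding dvd_minus_iff dvdm by blast
      then have "[v = y] (mod ?P) \<or> [v = y'] (mod ?P)"
      proof
        assume "?P dvd v + y"
        then have "[v = - y] (mod ?P)" by (simp add: cong_iff_dvd_diff)
        then show ?thesis using y' cong_sym cong_trans by blast
      qed (simp add: cong_iff_dvd_diff)
      then show ?thesis using ur yr yr' by (auto simp: ux cong_def)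
    qed
    have "{z \<in> A. f z = l} = {(x, y), (x, y')}"
      using in1 in2 in3 by (auto simp: l)
    moreover have "y \<noteq> y'"
    proof
      assume "y = y'"
      then have "?P dvd 2 * y" by (simp add: y'_def)
      then show False using ynd nd2 by (simp add: dvdm)
    qed
    ultimately show ?thesis by simp
  qed
  have finA: "finite A" by (rule finite_subset[of _ "carrier ?K"]) (auto simp: A_def carr)
  have cA: "card A = 2 * card (local_liars n p p (- 1))"
    by (rule card_two_to_one[OF finA _ fA fib]) auto
  \<comment> \<open>\<open>B\<close> is the part of the roots of unity lying in the prime field; it
    accounts for the subtracted gcd with \<open>p - 1\<close>.\<close>
  define B where "B = (\<lambda>x. (x, 0::int)) ` {x \<in> {1..<?P}. [x ^ (n - p) = 1] (mod ?P)}"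
  have cB: "card B = gcd (n - p) (p - 1)"
    unfolding B_def using card_roots_of_unity_mod[OF p(1), of "n - p"]
    by (subst card_image) (auto simp: inj_on_def)
  have "{\<alpha> \<in> carrier ?K - {\<zero>\<^bsub>?K\<^esub>}. \<alpha> [^]\<^bsub>?K\<^esub> (n - p) = \<one>\<^bsub>?K\<^esub>} = A \<union> B"
  proof -
    have Biff: "(x, 0) \<in> B \<longleftrightarrow> x \<in> {1..<?P} \<and> (x, 0) [^]\<^bsub>?K\<^esub> (n - p) = \<one>\<^bsub>?K\<^esub>" for x
      using quad_ext_pow_real[of x ?P \<nu> "n - p"] p1 by (auto simp: B_def quad_ext_def cong_def)
    have BD: "(x, y) \<in> B \<Longrightarrow> y = 0" for x y by (auto simp: B_def)
    have z: "\<zero>\<^bsub>?K\<^esub> = (0, 0)" by (simp add: quad_ext_def)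
    have "(x, y) \<in> {\<alpha> \<in> carrier ?K - {\<zero>\<^bsub>?K\<^esub>}. \<alpha> [^]\<^bsub>?K\<^esub> (n - p) = \<one>\<^bsub>?K\<^esub>} \<longleftrightarrow> (x, y) \<in> A \<union> B" for x y
    proof (cases "y = 0")
      case True
      then show ?thesis using Biff[of x] by (auto simp: A_def carr z)
    next
      case False
      then show ?thesis using BD[of x y] by (auto simp: A_def carr z)
    qed
    then show ?thesis unfolding set_eq_iff split_paired_All by blast
  qed
  then have "card (A \<union> B) = gcd (n - p) (card (carrier ?K) - 1)"
    using K.card_roots_of_unity[of "n - p"] by (simp add: carr)
  moreover have "card (A \<union> B) = card A + card B"
  proof (rule card_Un_disjoint[OF finA])
    show "finite B" by (rule finite_subset[of _ "carrier ?K"]) (auto simp: B_def carr)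
    show "A \<inter> B = {}" by (auto simp: A_def B_def)
  qed
  ultimately show ?thesis by (simp add: cA cB carr power2_eq_square)
qed

text \<open>Modulo 2 only \<open>X^2 + X + 1\<close> is admissible. Its root has order 3 and
  conjugate \<open>X^2\<close>, so the condition is \<open>n mod 3 = 2\<close>, and the symbol is
  \<open>-1\<close>.\<close>

lemma local_liars_2: "card (local_liars n 2 2 (- 1)) = (if n mod 3 = 2 then 1 else 0)"
  and local_liars_2_split: "local_liars n 2 2 1 = {}"
proof -
  \<comment> \<open>For these parameters the Lucas sequence has period 3:
    \<open>0, 1, -1\<close>.\<close>
  have U: "lucasU (- 1) 1 (3 * k) = 0 \<and> lucasU (- 1) 1 (3 * k + 1) = 1 \<and> lucasU (- 1) 1 (3 * k + 2) = - 1" for k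
    by (induction k) (simp_all add: numeral_eq_Suc)
  have cr: "conj_root n 2 1 1 \<longleftrightarrow> n mod 3 = 2"
  proof -
    define k where "k = n div 3"
    consider "n = 3 * k" | "n = 3 * k + 1" | "n = 3 * k + 2" unfolding k_def by linarith
    moreover have "(3 * k) mod 3 = 0" "(3 * k + 1) mod 3 = 1" "(3 * k + 2) mod 3 = 2" by presburger+
    ultimately show ?thesis
      using U[of k] by cases (auto simp: conj_root_def)
  qed
  have 01: "{0..<int 2} = {0, 1}" by auto
  have "(b, c) \<in> local_liars n 2 2 \<sigma> \<longleftrightarrow> b = 1 \<and> c = 1 \<and> \<sigma> = - 1 \<and> n mod 3 = 2" for b c \<sigma>
    unfolding local_liars_def 01 local_symbol_def using cr by auto
  then have "local_liars n 2 2 \<sigma> = (if \<sigma> = - 1 \<and> n mod 3 = 2 then {(1, 1)} else {})" for \<sigma>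
    by auto
  then show "card (local_liars n 2 2 (- 1)) = (if n mod 3 = 2 then 1 else 0)"
    "local_liars n 2 2 1 = {}" by auto
qed

lemma gcd_3_nat: "gcd 3 m = (if 3 dvd m then 3 else (1::nat))"
proof (cases "3 dvd m")
  case False
  then have "coprime 3 m" by (intro prime_imp_coprime) auto
  then show ?thesis using False by simp
qed (simp add: gcd_nat.absorb1)

section \<open>Comparison of the local counts with the terms \<open>C\<close> and
  \<open>D\<close>\<close>

lemma card_local_liars_C_term:
  assumes p: "Factorial_Ring.prime p" "p dvd n" and n: "n > 1"
  shows "real (card (local_liars n p p 1)) = C_term n p"
proof (cases "p = 2")
  case True
  \<comment> \<open>Both gcds in \<open>C_term\<close> are taken with \<open>p - 1 = 1\<close>, so
    their difference is 0.\<close>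
  then show ?thesis by (simp add: local_liars_2_split C_term_def)
next
  case False
  then have "p > 2" using p prime_ge_2_nat[of p] by linarith
  from card_local_liars_split[OF p(1) this n]
  have "2 * real (card (local_liars n p p 1)) + real (gcd (n - 1) (p - 1)) = real (gcd (n\<^sup>2 - 1) (p - 1))"
    by (metis of_nat_add of_nat_mult of_nat_numeral)
  then show ?thesis by (simp add: C_term_def)
qed

text \<open>Two gcd identities match the inert count with \<open>D_term\<close>:
  \<open>n^2 - 1 = (p^2 - 1) + (n + p) (n - p)\<close> reduces the threefold gcd to
  \<open>gcd (n - p) (p^2 - 1)\<close>, and \<open>n - 1 = (n - p) + (p - 1)\<close> replaces
  \<open>n - p\<close> by \<open>n - 1\<close> in the gcd with \<open>p - 1\<close>. At
  \<open>p = 2\<close> the value is \<open>(gcd(3, n - 2) - 1) / 2\<close>.\<close>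

lemma card_local_liars_D_term:
  assumes p: "Factorial_Ring.prime p" "p dvd n" and n: "n > 1"
  shows "real (card (local_liars n p p (- 1))) = D_term n p"
proof -
  have np: "p \<le> n" using p n dvd_imp_le by auto
  have p1: "p > 1" using p prime_gt_1_nat by auto
  have "n\<^sup>2 - 1 = (p\<^sup>2 - 1) + (n + p) * (n - p)"
  proof -
    obtain k where "n = p + k" using np le_Suc_ex by blast
    then have "n\<^sup>2 = p\<^sup>2 + (n + p) * (n - p)" by (simp add: power2_eq_square algebra_simps)
    moreover have "p\<^sup>2 \<ge> 1" using p1 by simp
    ultimately show ?thesis by linarith
  qed
  then have "gcd (p\<^sup>2 - 1) (n - p) dvd n\<^sup>2 - 1" by simp
  then have g1: "gcd (gcd (p\<^sup>2 - 1) (n\<^sup>2 - 1)) (n - p) = gcd (n - p) (p\<^sup>2 - 1)"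
    by (metis gcd.assoc gcd.commute gcd_nat.absorb1)
  have "n - 1 = (n - p) + (p - 1)" using np p1 by simp
  then have g2: "gcd (n - p) (p - 1) = gcd (n - 1) (p - 1)" by simp
  show ?thesis
  proof (cases "p = 2")
    case True
    have "3 dvd n - 2 \<longleftrightarrow> n mod 3 = 2" using np True by presburger
    then show ?thesis unfolding D_term_def g1 using g2
      by (simp add: True local_liars_2 gcd.commute[of "n - 2"] gcd_3_nat)
  next
    case False
    then have "p > 2" using p1 by linarith
    have "n > 0" using n by simp
    from card_local_liars_inert[OF p(1) \<open>p > 2\<close> p(2) this]
    have "2 * card (local_liars n p p (- 1)) + gcd (n - 1) (p - 1) = gcd (n - p) (p\<^sup>2 - 1)"
      unfolding g2 .
    then have "2 * real (card (local_liars n p p (- 1))) + real (gcd (n - 1) (p - 1)) = real (gcd (n - p) (p\<^sup>2 - 1))"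
      by (metis of_nat_add of_nat_mult of_nat_numeral)
    then show ?thesis unfolding D_term_def g1 by simp
  qed
qed

section \<open>Reduction of integer polynomials\<close>

text \<open>The elements \<open>g\<close> with \<open>f divides g \<otimes> B\<close> form an ideal,
  the quotient of \<open>(f)\<close> by \<open>B\<close>. If the ideal generated by \<open>S\<close>
  contains \<open>1\<close>, this yields that \<open>f\<close> divides \<open>B\<close>.\<close>

lemma (in cring) genideal_mult_divides:
  assumes "f \<in> carrier R" "B \<in> carrier R" "S \<subseteq> carrier R"
    and S: "\<And>a. a \<in> S \<Longrightarrow> f divides a \<otimes> B" and x: "x \<in> Idl S"
  shows "f divides x \<otimes> B"
proof -
  define I where "I = {g \<in> carrier R. f divides g \<otimes> B}"
  have "subgroup I (add_monoid R)"
  proof (rule subgroup.intro)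
    fix g h assume "g \<in> I" "h \<in> I"
    then obtain q r where *: "g \<in> carrier R" "h \<in> carrier R" "q \<in> carrier R" "r \<in> carrier R"
      "g \<otimes> B = f \<otimes> q" "h \<otimes> B = f \<otimes> r" by (auto simp: I_def factor_def)
    then have "(g \<oplus> h) \<otimes> B = f \<otimes> (q \<oplus> r)" using assms by (simp add: l_distr r_distr)
    then show "g \<otimes>\<^bsub>add_monoid R\<^esub> h \<in> I" using * by (auto simp: I_def factor_def)
  next
    have "\<zero> \<otimes> B = f \<otimes> \<zero>" using assms by simp
    then show "\<one>\<^bsub>add_monoid R\<^esub> \<in> I" by (auto simp: I_def factor_def)
  next
    fix g assume "g \<in> I"
    then obtain q where *: "g \<in> carrier R" "q \<in> carrier R" "g \<otimes> B = f \<otimes> q"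
      by (auto simp: I_def factor_def)
    then have "(\<ominus> g) \<otimes> B = f \<otimes> (\<ominus> q)" using assms by (simp add: l_minus r_minus)
    then have "\<ominus> g \<in> I" using * by (auto simp: I_def factor_def)
    then show "inv\<^bsub>add_monoid R\<^esub> g \<in> I" by (simp add: a_inv_def)
  qed (auto simp: I_def)
  then have "ideal I R"
  proof (rule idealI[OF ring_axioms])
    fix g y assume "g \<in> I" and y: "y \<in> carrier R"
    then obtain q where *: "g \<in> carrier R" "q \<in> carrier R" "g \<otimes> B = f \<otimes> q"
      by (auto simp: I_def factor_def)
    have "(y \<otimes> g) \<otimes> B = y \<otimes> (g \<otimes> B)" using assms(2) y * by (simp add: m_assoc)
    also have "\<dots> = f \<otimes> (y \<otimes> q)" using assms(1) y * by (simp add: m_lcomm)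
    finally have "(y \<otimes> g) \<otimes> B = f \<otimes> (y \<otimes> q)" .
    then show "y \<otimes> g \<in> I" "g \<otimes> y \<in> I" using * y
      by (auto simp: I_def factor_def m_comm[of g y])
  qed
  then have "Idl S \<subseteq> I" using S assms(3) by (intro genideal_minimal) (auto simp: I_def)
  then show ?thesis using x by (auto simp: I_def)
qed

text \<open>The reduction homomorphism onto \<open>Zpoly m\<close>, whose elements are coefficient
  functions. It is surjective with kernel the multiples of \<open>m\<close>, so computations can be
  done with integer polynomials.\<close>

definition poly_red :: "nat \<Rightarrow> int poly \<Rightarrow> (nat \<Rightarrow> int)" where
  "poly_red m P = (\<lambda>i. coeff P i mod int m)"

context
  fixes m :: nat
  assumes m: "m > 1"
begin

interpretation res: residues "int m" "Zmod m"
  by unfold_locales (use m in simp)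

interpretation P: UP_cring "Zmod m" "Zpoly m"
  by unfold_locales

lemma poly_red_closed [simp]: "poly_red m P \<in> carrier (Zpoly m)"
proof -
  have "poly_red m P \<in> up (Zmod m)"
  proof
    show "poly_red m P i \<in> carrier (Zmod m)" for i by (simp add: poly_red_def)
    show "\<exists>n. bound \<zero>\<^bsub>Zmod m\<^esub> n (poly_red m P)"
      by (intro exI[of _ "degree P"] bound.intro) (simp add: poly_red_def coeff_eq_0 res.res_zero_eq)
  qed
  then show ?thesis by (simp add: UP_def)
qed

lemma coeff_poly_red [simp]: "up_ring.coeff (Zpoly m) (poly_red m P) i = coeff P i mod int m"
  using poly_red_closed[of P] by (simp add: UP_def) (simp add: poly_red_def)

lemma poly_red_eqI:
  assumes "F \<in> carrier (Zpoly m)" "\<And>i. up_ring.coeff (Zpoly m) F i = coeff P i mod int m"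
  shows "F = poly_red m P"
  using assms by (intro P.up_eqI) auto

lemma poly_red_surj:
  assumes "F \<in> carrier (Zpoly m)"
  obtains P where "F = poly_red m P" "\<And>i. coeff P i = up_ring.coeff (Zpoly m) F i"
proof -
  let ?c = "up_ring.coeff (Zpoly m) F"
  have "?c i = 0" if "i > deg (Zmod m) F" for i
    using P.deg_aboveD[OF that assms] by (simp add: res.res_zero_eq)
  then have c: "coeff (Abs_poly ?c) = ?c" by (rule coeff_Abs_poly)
  have "?c i mod int m = ?c i" for i
    using P.coeff_closed[OF assms, of i] by (simp add: res.res_carrier_eq)
  then have "F = poly_red m (Abs_poly ?c)" using assms by (intro poly_red_eqI) (auto simp: c)
  then show ?thesis by (rule that) (simp add: c)
qed

lemma poly_red_add: "poly_red m P \<oplus>\<^bsub>Zpoly m\<^esub> poly_red m Q = poly_red m (P + Q)"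
  by (rule poly_red_eqI) (simp_all add: res.res_add_eq mod_simps)

lemma poly_red_mult: "poly_red m P \<otimes>\<^bsub>Zpoly m\<^esub> poly_red m Q = poly_red m (P * Q)"
proof (rule poly_red_eqI)
  fix i
  have "up_ring.coeff (Zpoly m) (poly_red m P \<otimes>\<^bsub>Zpoly m\<^esub> poly_red m Q) i =
      (\<Oplus>\<^bsub>Zmod m\<^esub>j\<in>{..i}. (coeff P j * coeff Q (i - j)) mod int m)"
    by (simp add: res.mult_cong)
  also have "\<dots> = coeff (P * Q) i mod int m"
    by (simp add: res.sum_cong coeff_mult)
  finally show "up_ring.coeff (Zpoly m) (poly_red m P \<otimes>\<^bsub>Zpoly m\<^esub> poly_red m Q) i = coeff (P * Q) i mod int m" .
qed simp

lemma poly_red_one: "\<one>\<^bsub>Zpoly m\<^esub> = poly_red m 1"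
  using m by (intro poly_red_eqI) (auto simp: res.res_one_eq res.res_zero_eq)

lemma poly_red_uminus: "\<ominus>\<^bsub>Zpoly m\<^esub> poly_red m P = poly_red m (- P)"
  by (rule poly_red_eqI) (simp_all add: P.coeff_a_inv res.neg_cong)

lemma poly_red_minus: "poly_red m P \<ominus>\<^bsub>Zpoly m\<^esub> poly_red m Q = poly_red m (P - Q)"
  unfolding a_minus_def poly_red_uminus poly_red_add by simp

lemma poly_red_eq_iff: "poly_red m P = poly_red m Q \<longleftrightarrow> (\<exists>R. P = Q + smult (int m) R)"
proof
  assume "poly_red m P = poly_red m Q"
  then have "int m dvd coeff P i - coeff Q i" for i
    unfolding poly_red_def fun_eq_iff by (simp add: mod_eq_dvd_iff)
  then have "[:int m:] dvd P - Q" by (simp add: const_poly_dvd_iff)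
  then obtain R where "P - Q = [:int m:] * R" by (rule dvdE)
  then have "P = Q + smult (int m) R" by (simp add: algebra_simps)
  then show "\<exists>R. P = Q + smult (int m) R" ..
qed (auto simp: poly_red_def)

lemma poly_red_divides_iff:
  "poly_red m (quad b c) divides\<^bsub>Zpoly m\<^esub> poly_red m P \<longleftrightarrow> vanishes (int m) b c P"
proof
  assume "poly_red m (quad b c) divides\<^bsub>Zpoly m\<^esub> poly_red m P"
  then obtain q where q: "q \<in> carrier (Zpoly m)" "poly_red m P = poly_red m (quad b c) \<otimes>\<^bsub>Zpoly m\<^esub> q"
    by (auto simp: factor_def)
  obtain Q where "q = poly_red m Q" using poly_red_surj[OF q(1)] by blast
  then have "poly_red m P = poly_red m (quad b c * Q)" using q by (simp add: poly_red_mult)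
  then show "vanishes (int m) b c P" unfolding poly_red_eq_iff vanishes_def by blast
next
  assume "vanishes (int m) b c P"
  then obtain Q R where "P = quad b c * Q + smult (int m) R" unfolding vanishes_def by blast
  then have "poly_red m P = poly_red m (quad b c * Q)" unfolding poly_red_eq_iff by blast
  then have "poly_red m P = poly_red m (quad b c) \<otimes>\<^bsub>Zpoly m\<^esub> poly_red m Q" by (simp add: poly_red_mult)
  then show "poly_red m (quad b c) divides\<^bsub>Zpoly m\<^esub> poly_red m P" by (auto simp: factor_def)
qed

lemma deg_poly_red_monic:
  assumes "lead_coeff P = 1"
  shows "deg (Zmod m) (poly_red m P) = degree P" "monic_poly m (poly_red m P)"
proof -
  show d: "deg (Zmod m) (poly_red m P) = degree P"
  proof (rule antisym)
    show "deg (Zmod m) (poly_red m P) \<le> degree P"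
      by (rule P.deg_aboveI) (simp_all add: coeff_eq_0 res.res_zero_eq)
    show "degree P \<le> deg (Zmod m) (poly_red m P)"
      by (rule P.deg_belowI) (use assms m in \<open>simp_all add: res.res_zero_eq\<close>)
  qed
  show "monic_poly m (poly_red m P)"
    using assms m by (simp add: d monic_poly_def res.res_one_eq)
qed

text \<open>The lift keeps the representatives of the coefficients, hence degree and leading
  coefficient. Degrees of products of monic polynomials can then be computed over a domain.\<close>

lemma monic_poly_obtain:
  assumes "monic_poly m F"
  obtains P where "F = poly_red m P" "lead_coeff P = 1" "degree P = deg (Zmod m) F"
    "\<And>i. coeff P i = up_ring.coeff (Zpoly m) F i"
proof -
  have F: "F \<in> carrier (Zpoly m)" and lc: "up_ring.coeff (Zpoly m) F (deg (Zmod m) F) = 1"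
    using assms by (auto simp: monic_poly_def res.res_one_eq)
  obtain P where P: "F = poly_red m P" "\<And>i. coeff P i = up_ring.coeff (Zpoly m) F i"
    using poly_red_surj[OF F] by blast
  have "degree P \<le> deg (Zmod m) F"
    using P.deg_aboveD[OF _ F] by (intro degree_le) (auto simp: P(2) res.res_zero_eq)
  moreover have "deg (Zmod m) F \<le> degree P" using lc by (intro le_degree) (simp add: P(2))
  ultimately have "degree P = deg (Zmod m) F" by simp
  then show ?thesis using P lc by (intro that) auto
qed

lemma Xpow_eq: "Xpow m k = poly_red m (monom 1 k)"
proof (rule poly_red_eqI)
  show "up_ring.coeff (Zpoly m) (Xpow m k) i = coeff (monom 1 k) i mod int m" for i
    unfolding Xpow_def P.coeff_monom[OF res.one_closed] using m
    by (simp add: res.res_one_eq res.res_zero_eq)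
qed (simp add: Xpow_def)

lemma subst_Xpow_quad:
  "subst_Xpow m k (poly_red m (quad b c)) = poly_red m ((monom 1 k)\<^sup>2 + [:b:] * monom 1 k + [:c:])"
proof -
  let ?f = "poly_red m (quad b c)"
  have const: "up_ring.monom (Zpoly m) (a mod int m) 0 = poly_red m [:a:]" for a
    by (rule poly_red_eqI) (auto simp: res.res_zero_eq coeff_pCons split: nat.splits)
  have d: "deg (Zmod m) ?f = 2" using deg_poly_red_monic(1)[of "quad b c"] by (simp add: quad_def)
  have pw: "poly_red m Q [^]\<^bsub>Zpoly m\<^esub> j = poly_red m (Q ^ j)" for Q and j :: nat
    by (induction j) (simp_all add: poly_red_one poly_red_mult mult.commute)
  have "subst_Xpow m k ?f = (\<Oplus>\<^bsub>Zpoly m\<^esub>i\<in>{..2}. poly_red m [:coeff (quad b c) i:] \<otimes>\<^bsub>Zpoly m\<^esub> poly_red m (monom 1 k ^ i))"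
    unfolding subst_Xpow_def P.eval_on_carrier[OF poly_red_closed] d coeff_poly_red const Xpow_eq pw ..
  also have "\<dots> = poly_red m ((monom 1 k)\<^sup>2 + [:b:] * monom 1 k + [:c:])"
    by (simp add: numeral_2_eq_2 atMost_Suc poly_red_mult poly_red_add quad_def add_ac)
  finally show ?thesis .
qed

end

section \<open>Liars with symbol \<open>-1\<close>\<close>

text \<open>\<open>X\<^sup>n = - b - X\<close> modulo \<open>f\<close>; substituting \<open>- b - X\<close> for \<open>X\<close> fixes \<open>f\<close>, so \<open>X^(n^2) = X\<close>.\<close>

lemma vanishes_square_power:
  assumes "vanishes m b c (monom 1 n + [:b, 1:])"
  shows "vanishes m b c (monom 1 (n\<^sup>2) - monom 1 1)"
proof -
  let ?v = "vanishes m b c"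
  \<comment> \<open>\<open>Y\<close> is the conjugate of \<open>X\<close>: composition with
    \<open>Y\<close> fixes \<open>f\<close> and sends \<open>X^n + X + b\<close> to
    \<open>Y^n - X\<close>. Combined with \<open>X^n = Y\<close> this gives
    \<open>(X^n)^n = X\<close>.\<close>
  define Y where "Y = [:- b, - 1:]"
  define A where "A = monom (1::int) n + [:b, 1:]"
  obtain q r where "A = quad b c * q + smult m r"
    using assms unfolding vanishes_def A_def by blast
  then have "pcompose A Y = pcompose (quad b c) Y * pcompose q Y + smult m (pcompose r Y)"
    by (simp add: pcompose_add pcompose_mult pcompose_smult)
  moreover have "pcompose (quad b c) Y = quad b c"
    by (simp add: quad_def Y_def pcompose_pCons algebra_simps)
  moreover have "pcompose A Y = Y ^ n - monom 1 1"
  proof -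
    have "pcompose (monom 1 n) Y = Y ^ n"
      by (induction n) (simp_all add: monom_Suc pcompose_pCons pcompose_1)
    moreover have "pcompose [:b, 1:] Y = - monom 1 1"
      by (simp add: pcompose_pCons Y_def monom_altdef)
    ultimately show ?thesis by (simp add: A_def pcompose_add)
  qed
  ultimately have "Y ^ n - monom 1 1 = quad b c * pcompose q Y + smult m (pcompose r Y)" by simp
  then have 1: "?v (Y ^ n - monom 1 1)" unfolding vanishes_def by blast
  have "monom 1 n - Y = A" by (simp add: A_def Y_def)
  then have "A dvd (monom 1 n) ^ n - Y ^ n" by (simp add: power_diff_sumr2)
  moreover have "?v A" using assms by (simp add: A_def)
  ultimately have 2: "?v ((monom 1 n) ^ n - Y ^ n)" by (rule vanishes_dvd)
  have "(monom 1 n) ^ n = monom (1::int) (n\<^sup>2)" by (simp add: monom_power power2_eq_square)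
  then show ?thesis using vanishes_add[OF 2 1] by simp
qed

text \<open>Modulo \<open>f\<close>, \<open>X^n - X\<close> is \<open>- W\<close> with
  \<open>W = 2 X + b\<close>, and \<open>W^2\<close> is the discriminant. Hence \<open>- d W\<close>
  is an inverse, where \<open>d\<close> inverts the discriminant.\<close>

lemma vanishes_bezout:
  assumes v: "vanishes m b c (monom 1 n + [:b, 1:])" and cp: "coprime (b\<^sup>2 - 4 * c) m"
  shows "\<exists>U. vanishes m b c (U * (monom 1 n - monom 1 1) - 1)"
proof -
  let ?v = "vanishes m b c"
  obtain d where d: "[(b\<^sup>2 - 4 * c) * d = 1] (mod m)"
    using cp by (auto simp: coprime_iff_invertible_int)
  define W where "W = [:b, 2:]"
  define U where "U = - [:d:] * W"
  have 1: "?v (U * (monom 1 n + [:b, 1:]))" by (rule vanishes_mult_left[OF v])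
  have 2: "?v (quad b c * [:4 * d:])" by (intro vanishes_mult vanishes_quad)
  have 3: "?v [:(b\<^sup>2 - 4 * c) * d - 1:]"
    using d vanishes_linear[of m b c _ 0] by (simp add: cong_iff_dvd_diff)
  have "U * (monom 1 n - monom 1 1) - 1 = U * (monom 1 n + [:b, 1:]) - U * W - 1"
  proof -
    have "monom 1 n - monom 1 1 = (monom 1 n + [:b, 1:]) - W"
      by (simp add: W_def monom_altdef)
    then show ?thesis by (simp only: right_diff_distrib)
  qed
  also have "\<dots> = U * (monom 1 n + [:b, 1:]) + (- U * W - 1)" by simp
  also have "- U * W - 1 = quad b c * [:4 * d:] + [:(b\<^sup>2 - 4 * c) * d - 1:]"
    by (simp add: U_def W_def quad_def one_pCons power2_eq_square algebra_simps)
  finally have "?v (U * (monom 1 n - monom 1 1) - 1)"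
    using vanishes_add[OF 1 vanishes_add[OF 2 3]] by simp
  then show ?thesis by blast
qed

context
  fixes n :: nat
  assumes n: "n > 1"
begin

interpretation res: residues "int n" "Zmod n"
  by unfold_locales (use n in simp)

interpretation P: UP_cring "Zmod n" "Zpoly n"
  by unfold_locales

lemma monic_power_diff:
  assumes "k > 1"
  shows "monic_poly n (Xpow n k \<ominus>\<^bsub>Zpoly n\<^esub> Xpow n 1)"
proof -
  have "degree (monom (1::int) k - monom 1 1) = k"
    unfolding diff_conv_add_uminus
    using assms by (subst degree_add_eq_left) (auto simp: degree_monom_eq)
  then have "lead_coeff (monom (1::int) k - monom 1 1) = 1" using assms by simp
  then show ?thesis unfolding Xpow_eq[OF n] poly_red_minus[OF n] by (rule deg_poly_red_monic[OF n])
qed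

text \<open>The witnesses are \<open>F1 = 1\<close>, \<open>f1 = F2 = f\<close> and
  \<open>f2 = 1\<close>: \<open>X^n - X\<close> is invertible modulo \<open>f\<close>, and
  \<open>f\<close> divides \<open>X^(n^2) - X\<close>.\<close>

lemma conj_root_imp_frobenius_liar:
  assumes np: "\<not> Factorial_Ring.prime n"
    and r: "b \<in> {0..<int n}" "c \<in> {0..<int n}"
    and cop: "coprime (int n) (c * (b\<^sup>2 - 4 * c))" and J: "Jacobi (b\<^sup>2 - 4 * c) n = - 1"
    and cr: "conj_root n (int n) b c"
  shows "frobenius_liar n (poly_red n (quad b c))"
proof -
  let ?f = "poly_red n (quad b c)" and ?P = "Zpoly n"
  have v: "vanishes (int n) b c (monom 1 n + [:b, 1:])"
    using cr n by (simp add: conj_root_iff_vanishes)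
  have f: "deg (Zmod n) ?f = 2" "monic_poly n ?f"
    using deg_poly_red_monic[OF n lead_coeff_quad] by auto
  have one: "monic_poly n \<one>\<^bsub>?P\<^esub>"
    unfolding poly_red_one[OF n] by (rule deg_poly_red_monic[OF n]) simp
  have d2: "disc2 n ?f = b\<^sup>2 - 4 * c" and c0: "up_ring.coeff ?P ?f 0 = c"
    using r n by (simp_all add: disc2_def quad_def)
  define A where "A = Xpow n n \<ominus>\<^bsub>?P\<^esub> Xpow n 1"
  have A: "A = poly_red n (monom 1 n - monom 1 1)" unfolding A_def Xpow_eq[OF n] poly_red_minus[OF n] ..
  have Ac: "A \<in> carrier ?P" using n by (simp add: A)
  have fc: "?f \<in> carrier ?P" using n by simp
  interpret I: ideal "Idl\<^bsub>?P\<^esub> {A, ?f}" ?P by (rule P.P.genideal_ideal) (use Ac fc in auto)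
  have g1: "is_gcmd n A ?f \<one>\<^bsub>?P\<^esub>"
  proof -
    have "coprime (b\<^sup>2 - 4 * c) (int n)" using cop by (simp add: coprime_commute)
    then obtain U where "vanishes (int n) b c (U * (monom 1 n - monom 1 1) - 1)"
      using vanishes_bezout[OF v] by blast
    then have "?f divides\<^bsub>?P\<^esub> poly_red n (U * (monom 1 n - monom 1 1) - 1)"
      by (simp add: poly_red_divides_iff[OF n])
    then obtain q where q: "q \<in> carrier ?P" "poly_red n (U * (monom 1 n - monom 1 1) - 1) = ?f \<otimes>\<^bsub>?P\<^esub> q"
      by (auto simp: factor_def)
    have "\<one>\<^bsub>?P\<^esub> = poly_red n U \<otimes>\<^bsub>?P\<^esub> A \<ominus>\<^bsub>?P\<^esub> ?f \<otimes>\<^bsub>?P\<^esub> q"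
      unfolding q(2)[symmetric] A poly_red_mult[OF n] poly_red_minus[OF n] poly_red_one[OF n] by simp
    moreover have "A \<in> Idl\<^bsub>?P\<^esub> {A, ?f}" "?f \<in> Idl\<^bsub>?P\<^esub> {A, ?f}"
      using P.P.genideal_self[of "{A, ?f}"] Ac fc by auto
    then have "poly_red n U \<otimes>\<^bsub>?P\<^esub> A \<in> Idl\<^bsub>?P\<^esub> {A, ?f}" "?f \<otimes>\<^bsub>?P\<^esub> q \<in> Idl\<^bsub>?P\<^esub> {A, ?f}"
      using I.I_l_closed I.I_r_closed q(1) n by auto
    then have "poly_red n U \<otimes>\<^bsub>?P\<^esub> A \<ominus>\<^bsub>?P\<^esub> ?f \<otimes>\<^bsub>?P\<^esub> q \<in> Idl\<^bsub>?P\<^esub> {A, ?f}"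
      unfolding a_minus_def by (intro I.a_closed I.a_inv_closed)
    ultimately have "\<one>\<^bsub>?P\<^esub> \<in> Idl\<^bsub>?P\<^esub> {A, ?f}" by simp
    then have "Idl\<^bsub>?P\<^esub> {A, ?f} = carrier ?P" by (rule I.one_imp_carrier)
    then show ?thesis
      unfolding is_gcmd_def using f one monic_power_diff[OF n] by (simp add: P.P.genideal_one A_def)
  qed
  define E where "E = Xpow n (n\<^sup>2) \<ominus>\<^bsub>?P\<^esub> Xpow n 1"
  have E: "E = poly_red n (monom 1 (n\<^sup>2) - monom 1 1)" unfolding E_def Xpow_eq[OF n] poly_red_minus[OF n] ..
  have Ec: "E \<in> carrier ?P" using n by (simp add: E)
  have g2: "is_gcmd n E ?f ?f"
  proof -
    have "?f divides\<^bsub>?P\<^esub> E"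
      unfolding E poly_red_divides_iff[OF n] by (rule vanishes_square_power[OF v])
    then obtain q where q: "q \<in> carrier ?P" "E = ?f \<otimes>\<^bsub>?P\<^esub> q" by (auto simp: factor_def)
    interpret J: ideal "Idl\<^bsub>?P\<^esub> {?f}" ?P by (rule P.P.genideal_ideal) (use fc in auto)
    have fs: "?f \<in> Idl\<^bsub>?P\<^esub> {?f}" using P.P.genideal_self'[OF fc] .
    have "E \<in> Idl\<^bsub>?P\<^esub> {?f}" unfolding q(2) by (rule J.I_r_closed[OF fs q(1)])
    then have "Idl\<^bsub>?P\<^esub> {E, ?f} \<subseteq> Idl\<^bsub>?P\<^esub> {?f}"
      using fs by (intro P.P.genideal_minimal[OF J.is_ideal]) auto
    moreover have "Idl\<^bsub>?P\<^esub> {?f} \<subseteq> Idl\<^bsub>?P\<^esub> {E, ?f}"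
      using P.P.genideal_self[of "{E, ?f}"] Ec fc
      by (intro P.P.genideal_minimal[OF P.P.genideal_ideal]) auto
    ultimately have "Idl\<^bsub>?P\<^esub> {E, ?f} = Idl\<^bsub>?P\<^esub> {?f}" by (rule subset_antisym)
    moreover have "n\<^sup>2 > 1" using n by (intro one_less_power) auto
    ultimately show ?thesis
      unfolding is_gcmd_def using f monic_power_diff by (simp add: E_def)
  qed
  have dv: "?f divides\<^bsub>?P\<^esub> subst_Xpow n n ?f"
  proof -
    have "(monom 1 n)\<^sup>2 + [:b:] * monom 1 n + [:c:] = (monom 1 n + [:b, 1:]) * (monom 1 n - monom 1 1) + quad b c"
      by (simp add: quad_def monom_altdef power2_eq_square algebra_simps)
    then have "vanishes (int n) b c ((monom 1 n)\<^sup>2 + [:b:] * monom 1 n + [:c:])"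
      using vanishes_add[OF vanishes_mult[OF v] vanishes_quad] by metis
    then show ?thesis unfolding subst_Xpow_quad[OF n] poly_red_divides_iff[OF n] .
  qed
  show ?thesis
    unfolding frobenius_liar_def
  proof (intro conjI exI)
    show "is_gcmd n (Xpow n n \<ominus>\<^bsub>?P\<^esub> Xpow n 1) ?f \<one>\<^bsub>?P\<^esub>" using g1 by (simp add: A_def)
    show "is_quotient n ?f \<one>\<^bsub>?P\<^esub> ?f" using fc by (simp add: is_quotient_def)
    show "is_gcmd n (Xpow n (n\<^sup>2) \<ominus>\<^bsub>?P\<^esub> Xpow n 1) ?f ?f" using g2 by (simp add: E_def)
    show "is_quotient n ?f ?f \<one>\<^bsub>?P\<^esub>" using fc by (simp add: is_quotient_def)
    show "gcd (int n) (up_ring.coeff ?P ?f 0 * disc2 n ?f) = 1"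
      unfolding d2 c0 using cop by (simp only: coprime_iff_gcd_eq_1)
  qed (use f J d2 dv n np in \<open>auto simp: monic_quadratics_def\<close>)
qed

text \<open>Once \<open>F1 = 1\<close>, the polynomials \<open>X^n - X\<close> and \<open>f\<close>
  generate the unit ideal, so \<open>X^n - X\<close> can be cancelled from
  \<open>(X^n - X) (X^n + X + b)\<close>, which condition (3) makes divisible by
  \<open>f\<close>.\<close>

lemma frobenius_liar_imp_conj_root:
  assumes r: "b \<in> {0..<int n}" "c \<in> {0..<int n}"
    and J: "Jacobi (b\<^sup>2 - 4 * c) n = - 1"
    and liar: "frobenius_liar n (poly_red n (quad b c))"
  shows "coprime (int n) (c * (b\<^sup>2 - 4 * c)) \<and> conj_root n (int n) b c"
proof -
  let ?f = "poly_red n (quad b c)" and ?P = "Zpoly n"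
  have f: "deg (Zmod n) ?f = 2" using deg_poly_red_monic[OF n lead_coeff_quad] by auto
  have fc: "?f \<in> carrier ?P" using n by simp
  have d2: "disc2 n ?f = b\<^sup>2 - 4 * c" and c0: "up_ring.coeff ?P ?f 0 = c"
    using r n by (simp_all add: disc2_def quad_def)
  define A where "A = Xpow n n \<ominus>\<^bsub>?P\<^esub> Xpow n 1"
  have A: "A = poly_red n (monom 1 n - monom 1 1)" unfolding A_def Xpow_eq[OF n] poly_red_minus[OF n] ..
  have Ac: "A \<in> carrier ?P" using n by (simp add: A)
  obtain F1 f1 F2 f2 where *: "gcd (int n) (c * (b\<^sup>2 - 4 * c)) = 1"
      "is_gcmd n A ?f F1" "is_quotient n ?f F1 f1"
      "is_gcmd n (Xpow n (n\<^sup>2) \<ominus>\<^bsub>?P\<^esub> Xpow n 1) f1 F2" "is_quotient n f1 F2 f2" "f2 = \<one>\<^bsub>?P\<^esub>"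
      "F2 divides\<^bsub>?P\<^esub> subst_Xpow n n F2" "even (deg (Zmod n) F2)"
      "(- 1) ^ (deg (Zmod n) F2 div 2) = (- 1 :: int)"
    using liar unfolding frobenius_liar_def d2 c0 J A_def[symmetric] by (elim conjE exE) (rule that; assumption)
  obtain P1 where P1: "F1 = poly_red n P1" "lead_coeff P1 = 1"
    using *(2) monic_poly_obtain[OF n] unfolding is_gcmd_def by metis
  obtain P2 where P2: "F2 = poly_red n P2" "lead_coeff P2 = 1" "degree P2 = deg (Zmod n) F2"
    using *(4) monic_poly_obtain[OF n] unfolding is_gcmd_def by metis
  have f1: "f1 = F2" using *(5,6) n by (simp add: is_quotient_def P2(1))
  have "?f = F1 \<otimes>\<^bsub>?P\<^esub> F2" using *(3) by (simp add: is_quotient_def f1)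
  also have "\<dots> = poly_red n (P1 * P2)" unfolding P1(1) P2(1) by (rule poly_red_mult[OF n])
  finally have fP: "?f = poly_red n (P1 * P2)" .
  have "deg (Zmod n) (poly_red n (P1 * P2)) = degree (P1 * P2)"
    using deg_poly_red_monic(1)[OF n, of "P1 * P2"] P1(2) P2(2) by (simp add: lead_coeff_mult)
  moreover have "P1 \<noteq> 0" "P2 \<noteq> 0" using P1(2) P2(2) by auto
  ultimately have deg: "2 = degree P1 + degree P2"
    unfolding fP[symmetric] f by (simp add: degree_mult_eq)
  \<comment> \<open>Degree 0 would give the sign \<open>+1\<close>. A positive even degree at most 2
    is 2, which leaves degree 0 for \<open>P1\<close>.\<close>
  have "degree P2 \<noteq> 0" using *(9) unfolding P2(3) by (intro notI) simp
  moreover have "even (degree P2)" using *(8) P2(3) by simp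
  ultimately have "degree P1 = 0" using deg by (cases "degree P2 = 1") auto
  then have "P1 = 1" using P1(2) by (metis degree_eq_zeroE lead_coeff_pCons(2) one_pCons)
  then have F1: "F1 = \<one>\<^bsub>?P\<^esub>" and F2: "F2 = ?f"
    using P1(1) P2(1) fP poly_red_one[OF n] by auto
  have "\<one>\<^bsub>?P\<^esub> \<in> Idl\<^bsub>?P\<^esub> {A, ?f}"
    using *(2) P.P.genideal_self'[OF P.P.one_closed] unfolding is_gcmd_def F1 by simp
  define B where "B = poly_red n (monom 1 n + [:b, 1:])"
  have Bc: "B \<in> carrier ?P" using n by (simp add: B_def)
  have "?f divides\<^bsub>?P\<^esub> \<one>\<^bsub>?P\<^esub> \<otimes>\<^bsub>?P\<^esub> B"
  proof (rule P.P.genideal_mult_divides[OF fc Bc])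
    show "{A, ?f} \<subseteq> carrier ?P" using Ac fc by simp
    have "(monom 1 n - monom 1 1) * (monom 1 n + [:b, 1:]) = ((monom 1 n)\<^sup>2 + [:b:] * monom 1 n + [:c:]) - quad b c"
      by (simp add: quad_def monom_altdef power2_eq_square algebra_simps)
    moreover have "vanishes (int n) b c ((monom 1 n)\<^sup>2 + [:b:] * monom 1 n + [:c:])"
      using *(7) unfolding F2 subst_Xpow_quad[OF n] poly_red_divides_iff[OF n] .
    ultimately have "vanishes (int n) b c ((monom 1 n - monom 1 1) * (monom 1 n + [:b, 1:]))"
      using vanishes_diff[OF _ vanishes_quad] by metis
    then have "?f divides\<^bsub>?P\<^esub> A \<otimes>\<^bsub>?P\<^esub> B"
      unfolding A B_def poly_red_mult[OF n] poly_red_divides_iff[OF n] .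
    moreover have "?f divides\<^bsub>?P\<^esub> ?f \<otimes>\<^bsub>?P\<^esub> B" using Bc by (auto simp: factor_def)
    ultimately show "?f divides\<^bsub>?P\<^esub> a \<otimes>\<^bsub>?P\<^esub> B" if "a \<in> {A, ?f}" for a using that by auto
  qed fact
  then have "?f divides\<^bsub>?P\<^esub> B" using Bc by simp
  then have "conj_root n (int n) b c"
    unfolding B_def poly_red_divides_iff[OF n] using n by (simp add: conj_root_iff_vanishes)
  then show ?thesis using *(1) by (simp add: coprime_iff_gcd_eq_1)
qed

lemma bij_betw_monic_quadratics:
  "bij_betw (\<lambda>(b, c). poly_red n (quad b c)) ({0..<int n} \<times> {0..<int n}) (monic_quadratics n)"
proof (rule bij_betw_imageI)
  show "inj_on (\<lambda>(b, c). poly_red n (quad b c)) ({0..<int n} \<times> {0..<int n})"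
  proof (rule inj_onI, clarify)
    fix b c b' c' assume r: "b \<in> {0..<int n}" "c \<in> {0..<int n}" "b' \<in> {0..<int n}" "c' \<in> {0..<int n}"
      and eq: "poly_red n (quad b c) = poly_red n (quad b' c')"
    have "coeff (quad b c) i mod int n = coeff (quad b' c') i mod int n" for i
      using fun_cong[OF eq, of i] by (simp add: poly_red_def)
    from this[of 0] this[of 1] show "b = b' \<and> c = c'" using r by (simp add: quad_def)
  qed
  show "(\<lambda>(b, c). poly_red n (quad b c)) ` ({0..<int n} \<times> {0..<int n}) = monic_quadratics n"
  proof (intro equalityI subsetI)
    fix F assume "F \<in> (\<lambda>(b, c). poly_red n (quad b c)) ` ({0..<int n} \<times> {0..<int n})"
    then show "F \<in> monic_quadratics n"
      using deg_poly_red_monic[OF n lead_coeff_quad] by (auto simp: monic_quadratics_def)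
  next
    fix F assume "F \<in> monic_quadratics n"
    then have F: "monic_poly n F" "deg (Zmod n) F = 2" by (auto simp: monic_quadratics_def)
    obtain P where P: "F = poly_red n P" "lead_coeff P = 1" "degree P = 2"
      "\<And>i. coeff P i = up_ring.coeff (Zpoly n) F i"
      using monic_poly_obtain[OF n F(1)] F(2) by metis
    have "P = quad (coeff P 1) (coeff P 0)"
    proof (rule poly_eqI)
      fix i :: nat
      consider "i = 0" | "i = 1" | "i = 2" | "i > 2" by linarith
      then show "coeff P i = coeff (quad (coeff P 1) (coeff P 0)) i"
        using P(2,3) by cases (auto simp: quad_def coeff_eq_0 numeral_2_eq_2)
    qed
    moreover have "coeff P i \<in> {0..<int n}" for i
      using P.coeff_closed[of F i] F(1) by (auto simp: P(4) monic_poly_def res.res_carrier_eq)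
    ultimately show "F \<in> (\<lambda>(b, c). poly_red n (quad b c)) ` ({0..<int n} \<times> {0..<int n})"
      using P(1) by (intro image_eqI[of _ _ "(coeff P 1, coeff P 0)"]) auto
  qed
qed

lemma L2_minus_eq_card:
  assumes np: "\<not> Factorial_Ring.prime n"
  shows "L2_minus n = card {(b, c) \<in> {0..<int n} \<times> {0..<int n}.
    coprime (int n) (c * (b\<^sup>2 - 4 * c)) \<and> conj_root n (int n) b c \<and> Jacobi (b\<^sup>2 - 4 * c) n = - 1}"
proof -
  let ?g = "\<lambda>(b, c). poly_red n (quad b c)" and ?D = "{0..<int n} \<times> {0..<int n}"
  define S where "S = {(b, c) \<in> ?D.
    coprime (int n) (c * (b\<^sup>2 - 4 * c)) \<and> conj_root n (int n) b c \<and> Jacobi (b\<^sup>2 - 4 * c) n = - 1}"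
  define L where "L = {f \<in> monic_quadratics n. frobenius_liar n f \<and> Jacobi (disc2 n f) n = - 1}"
  have inj: "inj_on ?g ?D" and img: "?g ` ?D = monic_quadratics n"
    using bij_betw_monic_quadratics by (auto simp: bij_betw_def)
  have iff: "?g x \<in> L \<longleftrightarrow> x \<in> S" if x: "x \<in> ?D" for x
  proof -
    obtain b c where bc: "x = (b, c)" by (cases x)
    have r: "b \<in> {0..<int n}" "c \<in> {0..<int n}" using x bc by auto
    have d2: "disc2 n (poly_red n (quad b c)) = b\<^sup>2 - 4 * c"
      using r n by (simp add: disc2_def quad_def)
    have "poly_red n (quad b c) \<in> monic_quadratics n"
      unfolding img[symmetric] using x by (intro image_eqI[of _ _ "(b, c)"]) (auto simp: bc)
    then show ?thesis
      using conj_root_imp_frobenius_liar[OF np r] frobenius_liar_imp_conj_root[OF r] r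
      by (auto simp: L_def S_def d2 bc)
  qed
  have "L \<subseteq> ?g ` ?D" unfolding img by (auto simp: L_def)
  moreover have "S \<subseteq> ?D" by (auto simp: S_def)
  ultimately have "L = ?g ` S" using iff by blast
  moreover have "inj_on ?g S" by (rule inj_on_subset[OF inj]) (auto simp: S_def)
  ultimately have "card L = card S" by (simp add: card_image)
  then show ?thesis by (simp add: L2_minus_def L_def S_def)
qed

end

section \<open>Counting\<close>

lemma dvd_iff_prime_powers_dvd:
  fixes x :: int
  assumes "n > 0"
  shows "int n dvd x \<longleftrightarrow> (\<forall>p\<in>prime_factors n. int (p ^ multiplicity p n) dvd x)"
proof
  assume *: "\<forall>p\<in>prime_factors n. int (p ^ multiplicity p n) dvd x"
  have "int (\<Prod>p\<in>A. p ^ multiplicity p n) dvd x" if "finite A" "A \<subseteq> prime_factors n" for A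
    using that
  proof (induction A rule: finite_induct)
    case (insert q A)
    have "coprime (q ^ multiplicity q n) (\<Prod>p\<in>A. p ^ multiplicity p n)"
      using insert by (intro prod_coprime_right)
        (metis coprime_power_left_iff coprime_power_right_iff in_prime_factors_imp_prime insert_subset primes_coprime subsetD)
    then have "coprime (int (q ^ multiplicity q n)) (int (\<Prod>p\<in>A. p ^ multiplicity p n))"
      unfolding coprime_int_iff .
    then show ?case using insert * by (simp add: divides_mult)
  qed simp
  from this[of "prime_factors n"] show "int n dvd x"
    using assms by (simp add: prime_factorization_nat[symmetric])
next
  assume *: "int n dvd x"
  show "\<forall>p\<in>prime_factors n. int (p ^ multiplicity p n) dvd x"
  proof
    fix p
    have "int (p ^ multiplicity p n) dvd int n" unfolding of_nat_dvd_iff by (rule multiplicity_dvd)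
    then show "int (p ^ multiplicity p n) dvd x" using * dvd_trans by blast
  qed
qed

lemma conj_root_iff_prime_powers:
  assumes "n > 0"
  shows "conj_root k (int n) b c \<longleftrightarrow>
    (\<forall>p\<in>prime_factors n. conj_root k (int (p ^ multiplicity p n)) b c)"
  unfolding conj_root_def dvd_iff_prime_powers_dvd[OF assms] by blast

lemma coprime_iff_prime_factors_not_dvd:
  fixes x :: int
  assumes "n > 0"
  shows "coprime (int n) x \<longleftrightarrow> (\<forall>p\<in>prime_factors n. \<not> int p dvd x)"
proof
  assume *: "coprime (int n) x"
  show "\<forall>p\<in>prime_factors n. \<not> int p dvd x"
  proof (intro ballI notI)
    fix p assume p: "p \<in> prime_factors n" "int p dvd x"
    then have "int p dvd int n" by auto
    then have "is_unit (int p)" using * p(2) coprime_common_divisor by blast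
    then show False using p(1) by (auto dest: in_prime_factors_imp_prime)
  qed
next
  assume *: "\<forall>p\<in>prime_factors n. \<not> int p dvd x"
  show "coprime (int n) x"
  proof (rule ccontr)
    assume "\<not> coprime (int n) x"
    then have "gcd (int n) x \<noteq> 1" by (simp add: coprime_iff_gcd_eq_1)
    then have "nat (gcd (int n) x) \<noteq> 1" by (metis nat_one_as_int gcd_ge_0_int int_nat_eq of_nat_1)
    then obtain p where p: "Factorial_Ring.prime p" "p dvd nat (gcd (int n) x)"
      using prime_factor_nat by blast
    then have "int p dvd gcd (int n) x" using int_dvd_int_iff[of p "nat (gcd (int n) x)"] by simp
    then have "int p dvd int n" "int p dvd x" by auto
    then show False using * p(1) assms by (auto simp: prime_factors_dvd)
  qed
qed

theorem theorem3p8: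
  fixes n :: nat
  assumes "n > 1" and "\<not> Factorial_Ring.prime n"
  shows "real (L2_minus n) =
    1 / 2 * (\<Prod>p\<in>prime_factors n. C_term n p + D_term n p) -
    1 / 2 * (\<Prod>p\<in>{p \<in> prime_factors n. even (multiplicity p n)}. C_term n p + D_term n p) *
            (\<Prod>p\<in>{p \<in> prime_factors n. odd (multiplicity p n)}. C_term n p - D_term n p)"
proof -
  let ?A = "prime_factors n" and ?r = "\<lambda>p. multiplicity p n"
  let ?D = "\<lambda>m::nat. {0..<int m} \<times> {0..<int m}"
  have n: "n > 0" using assms(1) by simp
  have pA: "Factorial_Ring.prime p" "p dvd n" "?r p > 0" if "p \<in> ?A" for p
    using that in_prime_factors_imp_prime[OF that] in_prime_factors_imp_dvd[OF that]
    by (auto simp: prime_factors_multiplicity)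
  have nprod: "(\<Prod>p\<in>?A. p ^ ?r p) = n" using n by (rule prime_factorization_nat[symmetric])
  define ok where "ok p b c \<longleftrightarrow> conj_root n (int (p ^ ?r p)) b c \<and> \<not> int p dvd c * (b\<^sup>2 - 4 * c)" for p b c
  define sym where "sym p b c = real_of_int (local_symbol (b\<^sup>2 - 4 * c) p)" for p b c
  \<comment> \<open>\<open>F\<close> is the local indicator and \<open>G\<close> the same weighted
    by the contribution of \<open>p\<close> to the Jacobi symbol.\<close>
  define F where "F p b c = (of_bool (ok p b c) :: real)" for p b c
  define G where "G p b c = F p b c * sym p b c ^ ?r p" for p b c
  have symv: "sym p b c = 1 \<or> sym p b c = - 1" if "p \<in> ?A" "ok p b c" for p b c
  proof -
    have nd: "\<not> int p dvd b\<^sup>2 - 4 * c" using that(2) by (auto simp: ok_def)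
    show ?thesis
    proof (cases "p = 2")
      case True
      then show ?thesis using nd by (auto simp: sym_def local_symbol_def)
    next
      case False
      then show ?thesis using nd by (auto simp: sym_def local_symbol_def Legendre_def cong_0_iff)
    qed
  qed
  have cond: "coprime (int n) (c * (b\<^sup>2 - 4 * c)) \<and> conj_root n (int n) b c \<longleftrightarrow> (\<forall>p\<in>?A. ok p b c)" for b c
    unfolding ok_def coprime_iff_prime_factors_not_dvd[OF n] conj_root_iff_prime_powers[OF n, of n]
    by blast
  \<comment> \<open>On admissible pairs the Jacobi symbol \<open>J\<close> is \<open>1\<close> or
    \<open>-1\<close>, so \<open>(1 - J) / 2\<close> is the indicator of \<open>J = - 1\<close>; on
    all other pairs both products are 0.\<close>
  have term_eq: "of_bool (coprime (int n) (c * (b\<^sup>2 - 4 * c)) \<and> conj_root n (int n) b c \<and> Jacobi (b\<^sup>2 - 4 * c) n = - 1)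
      = 1 / 2 * (\<Prod>p\<in>?A. F p b c) - 1 / 2 * (\<Prod>p\<in>?A. G p b c)" for b c
  proof (cases "\<forall>p\<in>?A. ok p b c")
    case True
    have F1: "(\<Prod>p\<in>?A. F p b c) = 1" using True by (intro prod.neutral) (simp add: F_def)
    have "(\<Prod>p\<in>?A. G p b c) = (\<Prod>p\<in>?A. sym p b c ^ ?r p)"
      using True by (intro prod.cong) (auto simp: G_def F_def)
    then have G1: "(\<Prod>p\<in>?A. G p b c) = real_of_int (Jacobi (b\<^sup>2 - 4 * c) n)"
      by (simp add: Jacobi_def sym_def)
    have "(\<Prod>p\<in>?A. \<bar>G p b c\<bar>) = 1"
    proof (rule prod.neutral, rule ballI)
      fix p assume p: "p \<in> ?A"
      then show "\<bar>G p b c\<bar> = 1" using symv[OF p, of b c] True by (auto simp: G_def F_def power_abs)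
    qed
    then have "\<bar>\<Prod>p\<in>?A. G p b c\<bar> = 1" by (simp add: abs_prod)
    then have "Jacobi (b\<^sup>2 - 4 * c) n = 1 \<or> Jacobi (b\<^sup>2 - 4 * c) n = - 1"
      unfolding G1 by (simp add: abs_if split: if_splits)
    then show ?thesis using cond[of c b] True by (auto simp: F1 G1)
  next
    case False
    then obtain p where "p \<in> ?A" "\<not> ok p b c" by blast
    then have z: "(\<Prod>p\<in>?A. F p b c) = 0" "(\<Prod>p\<in>?A. G p b c) = 0"
      by (auto intro!: prod_zero bexI[of _ p] simp: F_def G_def)
    have "\<not> (coprime (int n) (c * (b\<^sup>2 - 4 * c)) \<and> conj_root n (int n) b c \<and> Jacobi (b\<^sup>2 - 4 * c) n = - 1)"
      using cond[of c b] False by blast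
    then show ?thesis unfolding z by (simp only: of_bool_eq(1) mult_zero_right diff_self)
  qed
  have okc: "ok p b c \<longleftrightarrow> ok p b' c'" and symc: "ok p b c \<Longrightarrow> sym p b c = sym p b' c'"
    if p: "p \<in> ?A" and bc: "[b = b'] (mod int (p ^ ?r p))" "[c = c'] (mod int (p ^ ?r p))" for p b c b' c'
  proof -
    have "int p dvd int (p ^ ?r p)" using pA(3)[OF p] by (simp add: dvd_power)
    then have bc': "[b = b'] (mod int p)" "[c = c'] (mod int p)"
      using bc cong_dvd_modulus by blast+
    have "[c * (b\<^sup>2 - 4 * c) = c' * (b'\<^sup>2 - 4 * c')] (mod int p)"
      by (intro cong_mult cong_diff cong_pow bc' cong_refl)
    then show "ok p b c \<longleftrightarrow> ok p b' c'"
      unfolding ok_def using conj_root_cong[OF bc] cong_dvd_iff by blast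
    show "ok p b c \<Longrightarrow> sym p b c = sym p b' c'"
      using local_symbol_disc_cong[OF bc'] by (simp add: ok_def sym_def)
  qed
  have Fc: "F p b c = F p b' c'" and Gc: "G p b c = G p b' c'"
    if "p \<in> ?A" "[b = b'] (mod int (p ^ ?r p))" "[c = c'] (mod int (p ^ ?r p))" for p b c b' c'
    using okc[OF that] symc[OF that] by (auto simp: F_def G_def)
  \<comment> \<open>The exponent \<open>k\<close> is kept free: \<open>k = 0\<close> gives the plain
    count, and \<open>k\<close> equal to the multiplicity of \<open>p\<close> gives the signed
    count.\<close>
  have local: "(\<Sum>(b, c)\<in>?D (p ^ ?r p). F p b c * sym p b c ^ k) = C_term n p + (- 1) ^ k * D_term n p"
    if p: "p \<in> ?A" for p k
  proof -
    let ?L = "local_liars n p (p ^ ?r p)"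
    have split: "F p b c * sym p b c ^ k = of_bool ((b, c) \<in> ?L 1) + (- 1) ^ k * of_bool ((b, c) \<in> ?L (- 1))"
      if "(b, c) \<in> ?D (p ^ ?r p)" for b c
      using symv[OF p, of b c] that by (auto simp: F_def sym_def local_liars_def ok_def)
    have sub: "{z \<in> ?D (p ^ ?r p). z \<in> ?L \<sigma>} = ?L \<sigma>" for \<sigma> by (auto simp: local_liars_def)
    have cnt: "(\<Sum>z\<in>?D (p ^ ?r p). of_bool (z \<in> ?L \<sigma>)) = real (card (local_liars n p p \<sigma>))" for \<sigma>
    proof -
      have "(\<Sum>z\<in>?D (p ^ ?r p). of_bool (z \<in> ?L \<sigma>)) = real (card {z \<in> ?D (p ^ ?r p). z \<in> ?L \<sigma>})"
        by (simp add: of_bool_def sum.If_cases Int_def)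
      then show ?thesis unfolding sub
        using card_local_liars_prime_power[OF pA(1,2)[OF p] n pA(3)[OF p]] by simp
    qed
    have "(\<Sum>(b, c)\<in>?D (p ^ ?r p). F p b c * sym p b c ^ k) =
        (\<Sum>z\<in>?D (p ^ ?r p). of_bool (z \<in> ?L 1) + (- 1) ^ k * of_bool (z \<in> ?L (- 1)))"
      using split by (intro sum.cong) auto
    also have "\<dots> = real (card (local_liars n p p 1)) + (- 1) ^ k * real (card (local_liars n p p (- 1)))"
      unfolding sum.distrib sum_distrib_left[symmetric] cnt ..
    finally show ?thesis
      unfolding card_local_liars_C_term[OF pA(1,2)[OF p] assms(1)]
        card_local_liars_D_term[OF pA(1,2)[OF p] assms(1)] .
  qed
  have "real (L2_minus n) = (\<Sum>(b, c)\<in>?D n. of_bool (coprime (int n) (c * (b\<^sup>2 - 4 * c)) \<and>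
      conj_root n (int n) b c \<and> Jacobi (b\<^sup>2 - 4 * c) n = - 1))"
  proof -
    let ?Q = "\<lambda>(b, c). coprime (int n) (c * (b\<^sup>2 - 4 * c)) \<and> conj_root n (int n) b c \<and> Jacobi (b\<^sup>2 - 4 * c) n = - 1"
    have "{(b, c) \<in> ?D n. coprime (int n) (c * (b\<^sup>2 - 4 * c)) \<and> conj_root n (int n) b c \<and> Jacobi (b\<^sup>2 - 4 * c) n = - 1}
       = {z \<in> ?D n. ?Q z}" by auto
    then have "real (L2_minus n) = (\<Sum>z\<in>?D n. of_bool (?Q z))"
      unfolding L2_minus_eq_card[OF assms] by (simp add: of_bool_def sum.If_cases Int_def)
    then show ?thesis by (simp add: case_prod_unfold)
  qed
  also have "\<dots> = 1 / 2 * (\<Sum>(b, c)\<in>?D n. \<Prod>p\<in>?A. F p b c) - 1 / 2 * (\<Sum>(b, c)\<in>?D n. \<Prod>p\<in>?A. G p b c)"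
    unfolding term_eq by (simp add: case_prod_unfold sum_subtractf sum_distrib_left)
  also have "(\<Sum>(b, c)\<in>?D n. \<Prod>p\<in>?A. F p b c) = (\<Prod>p\<in>?A. \<Sum>(b, c)\<in>?D (p ^ ?r p). F p b c)"
    by (rule sum_prod_prime_powers[where A = ?A and e = ?r and F = F, unfolded nprod])
      (use pA(1) in \<open>auto intro: Fc\<close>)
  also have "\<dots> = (\<Prod>p\<in>?A. C_term n p + D_term n p)"
    using local[of _ 0] by (intro prod.cong) auto
  also have "(\<Sum>(b, c)\<in>?D n. \<Prod>p\<in>?A. G p b c) = (\<Prod>p\<in>?A. \<Sum>(b, c)\<in>?D (p ^ ?r p). G p b c)"
    by (rule sum_prod_prime_powers[where A = ?A and e = ?r and F = G, unfolded nprod])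
      (use pA(1) in \<open>auto intro: Gc\<close>)
  also have "\<dots> = (\<Prod>p\<in>?A. C_term n p + (- 1) ^ ?r p * D_term n p)"
    unfolding G_def using local by (intro prod.cong) auto
  \<comment> \<open>The sign in front of \<open>D_term\<close> is determined by the parity of the
    multiplicity, so the product is split accordingly.\<close>
  also have "\<dots> = (\<Prod>p\<in>{p \<in> ?A. even (?r p)} \<union> {p \<in> ?A. odd (?r p)}. C_term n p + (- 1) ^ ?r p * D_term n p)"
    by (rule prod.cong) auto
  also have "\<dots> = (\<Prod>p\<in>{p \<in> ?A. even (?r p)}. C_term n p + (- 1) ^ ?r p * D_term n p) *
      (\<Prod>p\<in>{p \<in> ?A. odd (?r p)}. C_term n p + (- 1) ^ ?r p * D_term n p)"
    by (rule prod.union_disjoint) auto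
  also have "(\<Prod>p\<in>{p \<in> ?A. even (?r p)}. C_term n p + (- 1) ^ ?r p * D_term n p) =
      (\<Prod>p\<in>{p \<in> ?A. even (?r p)}. C_term n p + D_term n p)"
    by (rule prod.cong) auto
  also have "(\<Prod>p\<in>{p \<in> ?A. odd (?r p)}. C_term n p + (- 1) ^ ?r p * D_term n p) =
      (\<Prod>p\<in>{p \<in> ?A. odd (?r p)}. C_term n p - D_term n p)"
    by (rule prod.cong) auto
  finally show ?thesis by (simp only: mult.assoc)
qed

end
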